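(* Let $\Gamma=(m_{i,j})_{n\times n}$ be a Coxeter matrix, and let the data $\Pi=\{(k_i,\alpha_i)\}_{i=1}^n$, $\kappa$ and $\bar q=\{q_1,\dots,q_n\}$ satisfy $q_i=\exp(\kappa\sqrt{-1}\pi k_i)$ for $1\le i\le n$. Then the map $X_i\mapsto\sigma_i$, $E_i\mapsto 0$ $(1\le i\le n)$ extends to a surjection (of algebras) from the BMW type algebra $B_\Gamma(\Pi,\kappa)$ to the Hecke algebra $H_\Gamma(\bar q)$.
   Context: **Words.** $[xy\cdots]_r$ is the word of length $r$ in which $x,y$ alternate, beginning with $x$. **Hecke algebra.** $A_\Gamma=\langle\sigma_1,\dots,\sigma_n\mid[\sigma_i\sigma_j\cdots]_{m_{i,j}}=[\sigma_j\sigma_i\cdots]_{m_{i,j}}\rangle$ is the Artin group. For $q_i\in\mathbb{C}^\times$ with $q_i=q_j$ whenever the Coxeter generators $s_i,s_j$ are conjugate in the Coxeter group $W_\Gamma$, $H_\Gamma(\bar q)$ is the quotient of $\mathbb{C}A_\Gamma$ by the two-sided ideal generated by $(\sigma_i-q_i)(\sigma_i+q_i^{-1})$, $1\le i\le n$. **Dihedral setting.** For an integer $m\ge 2$ let $D_m$ be the dihedral group of order $2m$ acting on $\mathbb{R}^2$ and on its complexification $\mathbb{C}^2$. For $0\le i\le m-1$ let $H_i$ be the line through $0$ making angle $i\pi/m$ (anticlockwise) with the $x$-axis (and also its complexification), $s_i$ the reflection in $H_i$, $f_i$ a linear form on $\mathbb{C}^2$ with kernel $H_i$, $\omega_i=df_i/f_i$,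 and $M_m=\mathbb{C}^2\setminus\bigcup_i H_i$. Write $w(H_i)=H_{w(i)}$ for $w\in D_m$. The Artin group is $A_{D_m}=\pi_1(M_m/D_m)=\langle \sigma_0,\sigma_1\mid[\sigma_0\sigma_1\cdots]_m=[\sigma_1\sigma_0\cdots]_m\rangle$; the base point is the image of a point $p$ in the open real sector between $H_0$ and $H_1$, and $\sigma_i$ ($i=0,1$) is the class of the image of the path which follows the segment from $p$ to $s_i(p)$ except that near $H_i$ it follows the small half circle $t\mapsto p_i'-(1-e^{\pi\sqrt{-1}t})\frac{\langle p_i',a_i\rangle}{\langle a_i,a_i\rangle}a_i$, $t\in[0,1]$, where $a_i=s_i(p)-p$ and $p_i'$ is the point of the segment slightly before it meets $H_i$. Let $V$ be the complex vector space with basis $v_0,\dots,v_{m-1}$ and $\iota(w)v_i=v_{w(i)}$. **Lawrence-Krammer representation $T_{LK}$.** If $m$ is odd, parameters are $(k,\alpha)\in\mathbb{C}^\times\times\mathbb{C}$ and $k_i=k,\alpha_i=\alpha$ for all $i$. If $m$ is even, parameters are $(k_0,k_1,\alpha_0,\alpha_1)\in(\mathbb{C}^\times)^2\times\mathbb{C}^2$, and $(k_i,\alpha_i)$ equals $(k_0,\alpha_0)$ for $i$ even and $(k_1,\alpha_1)$ for $i$ odd. Define $p_i(v_i)=\alpha_iv_i$ and $p_i(v_j)=\big(\sum_{t:\,s_t(H_j)=H_i}k_t\big)v_i$ for $j\ne i$. The connection $\Omega_m=\kappa\sum_{i=0}^{m-1}(k_i\iota(s_i)-p_i)\omega_i$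 on $M_m\times V$ is flat and $D_m$-invariant, so it induces a flat connection on $(M_m\times V)/D_m$ over $M_m/D_m$; $T_{LK}:A_{D_m}\to GL(V)$ is its monodromy representation (flat sections satisfy $dF=\Omega_m F$, so that for generic $\kappa$, $T_{LK}(\sigma_i)$ is conjugate to $\iota(s_i)\exp(\pi\sqrt{-1}\,\kappa(k_i\iota(s_i)-p_i))$). **The functions $\Phi$.** For $i=0,1$ put $q_i=\exp(\kappa k_i\pi\sqrt{-1})$, $l_i=\exp(\kappa\alpha_i\pi\sqrt{-1})/q_i$, $e_i=\frac{l_i}{q_i^{-1}-q_i}(T_{LK}(\sigma_i)-q_i)(T_{LK}(\sigma_i)+q_i^{-1})$; for generic parameters $e_i$ has rank one. Let $\Lambda$ be the free monoid on $X_0,X_1,E_0,E_1$ and $f:\Lambda\to\mathrm{End}(V)$ the monoid morphism with $f(X_i)=T_{LK}(\sigma_i)$, $f(E_i)=e_i$. $\Phi^i_{m,\Pi,\kappa}:\Lambda\to\mathbb{C}$ is defined by $e_if(X)e_i=\Phi^i_{m,\Pi,\kappa}(X)e_i$. **The algebra $B_\Gamma(\Pi,\kappa)$.** Let $s_1,\dots,s_n$ be the Coxeter generators of $W_\Gamma$; $(k_i,\alpha_i)\in\mathbb{C}^\times\times\mathbb{C}$, $1\le i\le n$, with $(k_i,\alpha_i)=(k_j,\alpha_j)$ whenever $s_i,s_j$ are conjugate; $\kappa\in\mathbb{C}$, $q_i=\exp(\kappa\sqrt{-1}\pi k_i)$, $l_i=\exp(\kappa\alpha_i\pi\sqrt{-1})/q_i$.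 For $i<j$ let $\Pi_{i,j}=\{(k_i,\alpha_i),(k_j,\alpha_j)\}$, let $\Lambda_{i,j}$ be the free monoid on $X_i,E_i,X_j,E_j$, and let $\Phi^i_{m_{i,j},\Pi_{i,j},\kappa},\Phi^j_{m_{i,j},\Pi_{i,j},\kappa}:\Lambda_{i,j}\to\mathbb{C}$ be the functions $\Phi^0,\Phi^1$ of $D_{m_{i,j}}$ with $X_0,E_0,X_1,E_1$ renamed $X_i,E_i,X_j,E_j$ and $(k_0,\alpha_0)=(k_i,\alpha_i)$, $(k_1,\alpha_1)=(k_j,\alpha_j)$ (these coincide if $m_{i,j}$ is odd). $B_\Gamma(\Pi,\kappa)$ is the $\mathbb{C}$-algebra generated by $X_i^{\pm},E_i$ ($1\le i\le n$), where $X_i=X_i^+$, with relations: (1) $X_iX_i^-=X_i^-X_i=1$; (2) $[X_iX_j\cdots]_{m_{i,j}}=[X_jX_i\cdots]_{m_{i,j}}$ for any $i\ne j$; (3) $(q_i^{-1}-q_i)E_i=l_i(X_i-q_i)(X_i+q_i^{-1})$; (4) $X_iE_i=E_iX_i=l_i^{-1}E_i$; (5) $E_iXE_i=\Phi^i_{m_{i,j},\Pi_{i,j},\kappa}(X)E_i$ and $E_jXE_j=\Phi^j_{m_{i,j},\Pi_{i,j},\kappa}(X)E_j$ for any $i<j$ (including pairs with $m_{i,j}=2$) and any $X\in\Lambda_{i,j}$; (6) $E_iXE_j=0=E_jXE_i$ for any $X\in\Lambda_{i,j}$ if $m_{i,j}$ is an even number greater than $2$. The parameters are assumed generic so that the algebra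 is defined (all $q_i^2\ne1$ and all operators $e_i$ used above of rank one). *)

theory Defs
  imports
    "HOL-Analysis.Smooth_Paths"
    "HOL-Algebra.Module"
    "HOL-Algebra.QuotRing"
    "Jordan_Normal_Form.DL_Rank"
begin

section \<open>Words, presented groups and complex algebras\<close>

fun alt :: "'a \<Rightarrow> 'a \<Rightarrow> nat \<Rightarrow> 'a list" where
  "alt x y 0 = []"
| "alt x y (Suc r) = x # alt y x r"

text \<open>A group word over \<open>S\<close> is a list of pairs \<open>(s, b)\<close>, where \<open>b = True\<close> stands for \<open>s\<close> and
  \<open>b = False\<close> for the inverse of \<open>s\<close>.\<close>

type_synonym 'a gword = "('a \<times> bool) list"

abbreviation gwords :: "'a set \<Rightarrow> 'a gword set" where
  "gwords S \<equiv> lists (S \<times> UNIV)"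

inductive pres_eq :: "'a set \<Rightarrow> ('a gword \<times> 'a gword) set \<Rightarrow> 'a gword \<Rightarrow> 'a gword \<Rightarrow> bool"
  for S :: "'a set" and R :: "('a gword \<times> 'a gword) set" where
  refl: "w \<in> gwords S \<Longrightarrow> pres_eq S R w w"
| sym: "pres_eq S R v w \<Longrightarrow> pres_eq S R w v"
| trans: "pres_eq S R u v \<Longrightarrow> pres_eq S R v w \<Longrightarrow> pres_eq S R u w"
| cancel: "a \<in> S \<Longrightarrow> u \<in> gwords S \<Longrightarrow> v \<in> gwords S
    \<Longrightarrow> pres_eq S R (u @ [(a, b), (a, \<not> b)] @ v) (u @ v)"
| rel: "(r, s) \<in> R \<Longrightarrow> r \<in> gwords S \<Longrightarrow> s \<in> gwords S \<Longrightarrow> u \<in> gwords S \<Longrightarrow> v \<in> gwords S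
    \<Longrightarrow> pres_eq S R (u @ r @ v) (u @ s @ v)"

definition pres_class :: "'a set \<Rightarrow> ('a gword \<times> 'a gword) set \<Rightarrow> 'a gword \<Rightarrow> 'a gword set" where
  "pres_class S R w = {v. pres_eq S R w v}"

definition presented_group ::
    "'a set \<Rightarrow> ('a gword \<times> 'a gword) set \<Rightarrow> 'a gword set monoid" where
  "presented_group S R =
    \<lparr>carrier = pres_class S R ` gwords S,
     mult = (\<lambda>A B. \<Union>u\<in>A. \<Union>v\<in>B. pres_class S R (u @ v)),
     one = pres_class S R []\<rparr>"

definition word_monoid :: "'a set \<Rightarrow> 'a list monoid" where
  "word_monoid S = \<lparr>carrier = lists S, mult = (@), one = []\<rparr>"

text \<open>The monoid algebra over the complex numbers, as finitely supported functions with
  convolution. It is the group algebra when \<open>G\<close> is a group, and the free algebra on \<open>S\<close> when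
  \<open>G = word_monoid S\<close>.\<close>

definition monoid_algebra :: "('g, 'x) monoid_scheme \<Rightarrow> (complex, 'g \<Rightarrow> complex) module" where
  "monoid_algebra G =
    \<lparr>carrier = {f. finite {x. f x \<noteq> 0} \<and> {x. f x \<noteq> 0} \<subseteq> carrier G},
     mult = (\<lambda>f g z. \<Sum>x\<in>{x. f x \<noteq> 0}. \<Sum>y\<in>{y. g y \<noteq> 0}.
                if x \<otimes>\<^bsub>G\<^esub> y = z then f x * g y else 0),
     one = (\<lambda>z. if z = \<one>\<^bsub>G\<^esub> then 1 else 0),
     zero = (\<lambda>z. 0),
     add = (\<lambda>f g z. f z + g z),
     smult = (\<lambda>c f z. c * f z)\<rparr>"

definition delta :: "'g \<Rightarrow> 'g \<Rightarrow> complex" where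
  "delta x = (\<lambda>z. if z = x then 1 else 0)"

definition quot_algebra :: "(complex, 'a) module \<Rightarrow> 'a set \<Rightarrow> (complex, 'a set) module" where
  "quot_algebra A I =
    \<lparr>carrier = carrier (A Quot I), mult = mult (A Quot I), one = one (A Quot I),
     zero = zero (A Quot I), add = add (A Quot I),
     smult = (\<lambda>c Y. \<Union>y\<in>Y. I +>\<^bsub>A\<^esub> (c \<odot>\<^bsub>A\<^esub> y))\<rparr>"

definition algebra_hom ::
    "(complex, 'a) module \<Rightarrow> (complex, 'b) module \<Rightarrow> ('a \<Rightarrow> 'b) set" where
  "algebra_hom A B = {\<phi> \<in> Ring.ring_hom A B.
     \<forall>c. \<forall>x\<in>carrier A. \<phi> (c \<odot>\<^bsub>A\<^esub> x) = c \<odot>\<^bsub>B\<^esub> \<phi> x}"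


section \<open>Coxeter groups, Artin groups and Hecke algebras\<close>

text \<open>Generators are indexed by \<open>{1..n}\<close>; all entries of a Coxeter matrix are finite here, as
  the dihedral data attached below to each pair \<open>i < j\<close> require.\<close>

definition coxeter_matrix :: "nat \<Rightarrow> (nat \<Rightarrow> nat \<Rightarrow> nat) \<Rightarrow> bool" where
  "coxeter_matrix n m \<longleftrightarrow> (\<forall>i\<in>{1..n}. \<forall>j\<in>{1..n}.
     m i i = 1 \<and> m i j = m j i \<and> (i \<noteq> j \<longrightarrow> 2 \<le> m i j))"

definition coxeter_rels :: "nat \<Rightarrow> (nat \<Rightarrow> nat \<Rightarrow> nat) \<Rightarrow> (nat gword \<times> nat gword) set" where
  "coxeter_rels n m =
    {(concat (replicate (m i j) [(i, True), (j, True)]), []) | i j. i \<in> {1..n} \<and> j \<in> {1..n}}"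

definition coxeter_group :: "nat \<Rightarrow> (nat \<Rightarrow> nat \<Rightarrow> nat) \<Rightarrow> nat gword set monoid" where
  "coxeter_group n m = presented_group {1..n} (coxeter_rels n m)"

definition coxeter_gen :: "nat \<Rightarrow> (nat \<Rightarrow> nat \<Rightarrow> nat) \<Rightarrow> nat \<Rightarrow> nat gword set" where
  "coxeter_gen n m i = pres_class {1..n} (coxeter_rels n m) [(i, True)]"

definition gens_conjugate :: "nat \<Rightarrow> (nat \<Rightarrow> nat \<Rightarrow> nat) \<Rightarrow> nat \<Rightarrow> nat \<Rightarrow> bool" where
  "gens_conjugate n m i j \<longleftrightarrow> (\<exists>w\<in>carrier (coxeter_group n m).
     w \<otimes>\<^bsub>coxeter_group n m\<^esub> coxeter_gen n m i \<otimes>\<^bsub>coxeter_group n m\<^esub>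
       inv\<^bsub>coxeter_group n m\<^esub> w = coxeter_gen n m j)"

definition artin_rels :: "nat \<Rightarrow> (nat \<Rightarrow> nat \<Rightarrow> nat) \<Rightarrow> (nat gword \<times> nat gword) set" where
  "artin_rels n m =
    {(alt (i, True) (j, True) (m i j), alt (j, True) (i, True) (m i j)) | i j.
       i \<in> {1..n} \<and> j \<in> {1..n} \<and> i \<noteq> j}"

definition artin_group :: "nat \<Rightarrow> (nat \<Rightarrow> nat \<Rightarrow> nat) \<Rightarrow> nat gword set monoid" where
  "artin_group n m = presented_group {1..n} (artin_rels n m)"

abbreviation artin_algebra ::
    "nat \<Rightarrow> (nat \<Rightarrow> nat \<Rightarrow> nat) \<Rightarrow> (complex, nat gword set \<Rightarrow> complex) module" where
  "artin_algebra n m \<equiv> monoid_algebra (artin_group n m)"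

definition artin_sigma ::
    "nat \<Rightarrow> (nat \<Rightarrow> nat \<Rightarrow> nat) \<Rightarrow> nat \<Rightarrow> nat gword set \<Rightarrow> complex" where
  "artin_sigma n m i = delta (pres_class {1..n} (artin_rels n m) [(i, True)])"

text \<open>\<open>quad A q x\<close> is \<open>(x - q) (x + 1/q)\<close> in the algebra \<open>A\<close>.\<close>

definition quad :: "(complex, 'a) module \<Rightarrow> complex \<Rightarrow> 'a \<Rightarrow> 'a" where
  "quad A q x = (x \<ominus>\<^bsub>A\<^esub> q \<odot>\<^bsub>A\<^esub> \<one>\<^bsub>A\<^esub>) \<otimes>\<^bsub>A\<^esub> (x \<oplus>\<^bsub>A\<^esub> inverse q \<odot>\<^bsub>A\<^esub> \<one>\<^bsub>A\<^esub>)"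

definition hecke_ideal ::
    "nat \<Rightarrow> (nat \<Rightarrow> nat \<Rightarrow> nat) \<Rightarrow> (nat \<Rightarrow> complex) \<Rightarrow> (nat gword set \<Rightarrow> complex) set" where
  "hecke_ideal n m q = Idl\<^bsub>artin_algebra n m\<^esub>
     {quad (artin_algebra n m) (q i) (artin_sigma n m i) | i. i \<in> {1..n}}"

definition hecke_algebra :: "nat \<Rightarrow> (nat \<Rightarrow> nat \<Rightarrow> nat) \<Rightarrow> (nat \<Rightarrow> complex)
    \<Rightarrow> (complex, (nat gword set \<Rightarrow> complex) set) module" where
  "hecke_algebra n m q = quot_algebra (artin_algebra n m) (hecke_ideal n m q)"

definition hecke_sigma :: "nat \<Rightarrow> (nat \<Rightarrow> nat \<Rightarrow> nat) \<Rightarrow> (nat \<Rightarrow> complex) \<Rightarrow> nat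
    \<Rightarrow> (nat gword set \<Rightarrow> complex) set" where
  "hecke_sigma n m q i = hecke_ideal n m q +>\<^bsub>artin_algebra n m\<^esub> artin_sigma n m i"


section \<open>The dihedral arrangement\<close>

definition line_dir :: "nat \<Rightarrow> nat \<Rightarrow> real \<times> real" where
  "line_dir m i = (cos (real i * pi / real m), sin (real i * pi / real m))"

definition mirror :: "nat \<Rightarrow> nat \<Rightarrow> (real \<times> real) set" where
  "mirror m i = range (\<lambda>t. t *\<^sub>R line_dir m i)"

definition reflection :: "nat \<Rightarrow> nat \<Rightarrow> real \<times> real \<Rightarrow> real \<times> real" where
  "reflection m i x = (2 * inner x (line_dir m i)) *\<^sub>R line_dir m i - x"

text \<open>The action of \<open>s\<^sub>i\<close> on indices of mirrors: \<open>s\<^sub>i(H\<^sub>j) = H\<^sub>l\<close> for \<open>l = mirror_index m i j\<close>.\<close>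

definition mirror_index :: "nat \<Rightarrow> nat \<Rightarrow> nat \<Rightarrow> nat" where
  "mirror_index m i j = (THE l. l < m \<and> reflection m i ` mirror m j = mirror m l)"

text \<open>A linear form on \<open>\<complex>\<^sup>2\<close> with kernel the complexification of \<open>mirror m i\<close>. Rescaling it does
  not change the logarithmic form \<open>\<omega>\<^sub>i\<close>.\<close>

definition line_form :: "nat \<Rightarrow> nat \<Rightarrow> complex \<times> complex \<Rightarrow> complex" where
  "line_form m i z = of_real (sin (real i * pi / real m)) * fst z
                   - of_real (cos (real i * pi / real m)) * snd z"

text \<open>The value at \<open>z\<close> of \<open>\<omega>\<^sub>i = df\<^sub>i / f\<^sub>i\<close> on the tangent vector \<open>u\<close>.\<close>

definition log_form :: "nat \<Rightarrow> nat \<Rightarrow> complex \<times> complex \<Rightarrow> complex \<times> complex \<Rightarrow> complex" where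
  "log_form m i z u = line_form m i u / line_form m i z"

definition sector :: "nat \<Rightarrow> (real \<times> real) set" where
  "sector m = {(r * cos \<theta>, r * sin \<theta>) | r \<theta>. 0 < r \<and> 0 < \<theta> \<and> \<theta> < pi / real m}"

definition complexify :: "real \<times> real \<Rightarrow> complex \<times> complex" where
  "complexify x = (of_real (fst x), of_real (snd x))"

text \<open>The base point is an arbitrary point of the open sector: another choice conjugates
  the two monodromy operators below by the same parallel transport and so does not change the
  functions \<open>\<Phi>\<close>.\<close>

definition base_point :: "nat \<Rightarrow> real \<times> real" where
  "base_point m = (SOME p. p \<in> sector m)"

text \<open>The segment from the base point \<open>p\<close> to \<open>s\<^sub>i(p)\<close> meets \<open>H\<^sub>i\<close> in its midpoint. For \<open>i = 0, 1\<close> it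
  meets no other mirror, and the half circle meets real points only in its end points; so all
  choices of a point of the segment before \<open>H\<^sub>i\<close> give homotopic paths.\<close>

definition near_point :: "nat \<Rightarrow> nat \<Rightarrow> real \<times> real" where
  "near_point m i =
    (SOME x. x \<in> open_segment (base_point m) (midpoint (base_point m) (reflection m i (base_point m))))"

definition half_circle :: "nat \<Rightarrow> nat \<Rightarrow> real \<Rightarrow> complex \<times> complex" where
  "half_circle m i t =
    (let a = reflection m i (base_point m) - base_point m;
         p' = near_point m i;
         c = (1 - exp (of_real pi * \<i> * of_real t)) * of_real (inner p' a / inner a a)
     in complexify p' - (c * of_real (fst a), c * of_real (snd a)))"

definition sigma_path :: "nat \<Rightarrow> nat \<Rightarrow> real \<Rightarrow> complex \<times> complex" where
  "sigma_path m i =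
     linepath (complexify (base_point m)) (complexify (near_point m i))
     +++ (half_circle m i
     +++ linepath (complexify (reflection m i (near_point m i)))
                  (complexify (reflection m i (base_point m))))"


section \<open>The Lawrence-Krammer connection and its monodromy\<close>

text \<open>Operators on \<open>V\<close> are \<open>m \<times> m\<close> matrices with respect to the basis
  \<open>v\<^sub>0, \<dots>, v\<^sub>m\<^sub>-\<^sub>1\<close>. The parameters are given by their values at \<open>0\<close> and \<open>1\<close>; for odd \<open>m\<close> only the
  value at \<open>0\<close> matters.\<close>

definition lk_param :: "nat \<Rightarrow> (nat \<Rightarrow> complex) \<Rightarrow> nat \<Rightarrow> complex" where
  "lk_param m k i = (if odd m \<or> even i then k 0 else k 1)"

definition iota :: "nat \<Rightarrow> nat \<Rightarrow> complex mat" where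
  "iota m i = mat m m (\<lambda>(a, b). if a = mirror_index m i b then 1 else 0)"

definition lk_p :: "nat \<Rightarrow> (nat \<Rightarrow> complex) \<Rightarrow> (nat \<Rightarrow> complex) \<Rightarrow> nat \<Rightarrow> complex mat" where
  "lk_p m k \<alpha> i = mat m m (\<lambda>(a, b).
     if a \<noteq> i then 0
     else if b = i then lk_param m \<alpha> i
     else (\<Sum>t\<in>{t. t < m \<and> reflection m t ` mirror m b = mirror m i}. lk_param m k t))"

definition lk_Omega :: "nat \<Rightarrow> (nat \<Rightarrow> complex) \<Rightarrow> (nat \<Rightarrow> complex) \<Rightarrow> complex
    \<Rightarrow> complex \<times> complex \<Rightarrow> complex \<times> complex \<Rightarrow> complex mat" where
  "lk_Omega m k \<alpha> \<kappa> z u = mat m m (\<lambda>ab.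
     \<kappa> * (\<Sum>i<m. (lk_param m k i \<cdot>\<^sub>m iota m i - lk_p m k \<alpha> i) $$ ab * log_form m i z u))"

text \<open>The columns of \<open>Y\<close> are flat sections along the piecewise smooth path \<open>\<gamma>\<close>, that is, they
  solve \<open>dF = \<Omega> F\<close> along \<open>\<gamma>\<close>; the finite set contains the corners of \<open>\<gamma>\<close>.\<close>

definition flat_frame :: "nat \<Rightarrow> (complex \<times> complex \<Rightarrow> complex \<times> complex \<Rightarrow> complex mat)
    \<Rightarrow> (real \<Rightarrow> complex \<times> complex) \<Rightarrow> (real \<Rightarrow> complex mat) \<Rightarrow> bool" where
  "flat_frame m \<Omega> \<gamma> Y \<longleftrightarrow>
    (\<forall>t\<in>{0..1}. Y t \<in> carrier_mat m m) \<and>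
    (\<forall>a<m. \<forall>b<m. continuous_on {0..1} (\<lambda>t. Y t $$ (a, b))) \<and>
    (\<exists>S. finite S \<and> (\<forall>t\<in>{0..1} - S. \<forall>a<m. \<forall>b<m.
       ((\<lambda>t. Y t $$ (a, b)) has_vector_derivative
          (\<Omega> (\<gamma> t) (vector_derivative \<gamma> (at t)) * Y t) $$ (a, b)) (at t)))"

definition transport :: "nat \<Rightarrow> (complex \<times> complex \<Rightarrow> complex \<times> complex \<Rightarrow> complex mat)
    \<Rightarrow> (real \<Rightarrow> complex \<times> complex) \<Rightarrow> complex mat" where
  "transport m \<Omega> \<gamma> = (THE P. \<exists>Y. flat_frame m \<Omega> \<gamma> Y \<and> Y 0 = 1\<^sub>m m \<and> Y 1 = P)"

text \<open>In \<open>(M\<^sub>m \<times> V)/D\<^sub>m\<close> the point \<open>(s\<^sub>i(p), v)\<close> is identified with \<open>(p, \<iota>(s\<^sub>i) v)\<close>; hence the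
  factor \<open>iota m i\<close>.\<close>

definition T_LK :: "nat \<Rightarrow> (nat \<Rightarrow> complex) \<Rightarrow> (nat \<Rightarrow> complex) \<Rightarrow> complex \<Rightarrow> nat \<Rightarrow> complex mat" where
  "T_LK m k \<alpha> \<kappa> i = iota m i * transport m (lk_Omega m k \<alpha> \<kappa>) (sigma_path m i)"

definition q_par :: "complex \<Rightarrow> complex \<Rightarrow> complex" where
  "q_par \<kappa> k = exp (\<kappa> * k * of_real pi * \<i>)"

definition l_par :: "complex \<Rightarrow> complex \<Rightarrow> complex \<Rightarrow> complex" where
  "l_par \<kappa> k \<alpha> = exp (\<kappa> * \<alpha> * of_real pi * \<i>) / q_par \<kappa> k"

definition lk_e :: "nat \<Rightarrow> (nat \<Rightarrow> complex) \<Rightarrow> (nat \<Rightarrow> complex) \<Rightarrow> complex \<Rightarrow> nat \<Rightarrow> complex mat" where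
  "lk_e m k \<alpha> \<kappa> i =
    (let q = q_par \<kappa> (lk_param m k i);
         l = l_par \<kappa> (lk_param m k i) (lk_param m \<alpha> i);
         T = T_LK m k \<alpha> \<kappa> i
     in (l / (inverse q - q)) \<cdot>\<^sub>m ((T - q \<cdot>\<^sub>m 1\<^sub>m m) * (T + inverse q \<cdot>\<^sub>m 1\<^sub>m m)))"

text \<open>The letters \<open>X\<^sub>i\<close> and \<open>E\<^sub>i\<close>; words in them are the elements of the free monoids \<open>\<Lambda>\<close>.\<close>

datatype 'i letter = XL 'i | EL 'i

fun lk_letter :: "nat \<Rightarrow> (nat \<Rightarrow> complex) \<Rightarrow> (nat \<Rightarrow> complex) \<Rightarrow> complex \<Rightarrow> nat letter
    \<Rightarrow> complex mat" where
  "lk_letter m k \<alpha> \<kappa> (XL i) = T_LK m k \<alpha> \<kappa> i"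
| "lk_letter m k \<alpha> \<kappa> (EL i) = lk_e m k \<alpha> \<kappa> i"

definition lk_word :: "nat \<Rightarrow> (nat \<Rightarrow> complex) \<Rightarrow> (nat \<Rightarrow> complex) \<Rightarrow> complex \<Rightarrow> nat letter list
    \<Rightarrow> complex mat" where
  "lk_word m k \<alpha> \<kappa> w = foldr (\<lambda>x A. lk_letter m k \<alpha> \<kappa> x * A) w (1\<^sub>m m)"

text \<open>\<open>lk_Phi m k \<alpha> \<kappa> i\<close> is the function \<open>\<Phi>\<^sup>i\<close> on words in the letters with indices \<open>0\<close> and \<open>1\<close>; the
  scalar exists and is unique when \<open>lk_e m k \<alpha> \<kappa> i\<close> has rank one.\<close>

definition lk_Phi :: "nat \<Rightarrow> (nat \<Rightarrow> complex) \<Rightarrow> (nat \<Rightarrow> complex) \<Rightarrow> complex \<Rightarrow> nat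
    \<Rightarrow> nat letter list \<Rightarrow> complex" where
  "lk_Phi m k \<alpha> \<kappa> i w =
    (THE c. lk_e m k \<alpha> \<kappa> i * lk_word m k \<alpha> \<kappa> w * lk_e m k \<alpha> \<kappa> i = c \<cdot>\<^sub>m lk_e m k \<alpha> \<kappa> i)"


section \<open>The BMW type algebra\<close>

text \<open>Restriction of the parameters to the pair \<open>(i, j)\<close>, with \<open>i\<close> renamed \<open>0\<close> and \<open>j\<close> renamed
  \<open>1\<close>.\<close>

definition pair_param :: "(nat \<Rightarrow> complex) \<Rightarrow> nat \<Rightarrow> nat \<Rightarrow> nat \<Rightarrow> complex" where
  "pair_param f i j = (\<lambda>a. if a = 0 then f i else f j)"

definition pair_words :: "nat \<Rightarrow> nat \<Rightarrow> nat letter list set" where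
  "pair_words i j = lists {XL i, EL i, XL j, EL j}"

definition pair_index :: "nat \<Rightarrow> nat \<Rightarrow> nat" where
  "pair_index i b = (if b = i then 0 else 1)"

text \<open>For \<open>i < j\<close> and \<open>b \<in> {i, j}\<close> this is \<open>\<Phi>\<^sup>b\<close> for the pair \<open>(i, j)\<close>, on \<open>pair_words i j\<close>.\<close>

definition bmw_Phi :: "(nat \<Rightarrow> nat \<Rightarrow> nat) \<Rightarrow> (nat \<Rightarrow> complex) \<Rightarrow> (nat \<Rightarrow> complex) \<Rightarrow> complex
    \<Rightarrow> nat \<Rightarrow> nat \<Rightarrow> nat \<Rightarrow> nat letter list \<Rightarrow> complex" where
  "bmw_Phi m k \<alpha> \<kappa> i j b w =
    lk_Phi (m i j) (pair_param k i j) (pair_param \<alpha> i j) \<kappa> (pair_index i b)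
      (map (map_letter (pair_index i)) w)"

datatype bmw_gen = Letter "nat letter" | XInv nat

definition bmw_gens :: "nat \<Rightarrow> bmw_gen set" where
  "bmw_gens n = (\<Union>i\<in>{1..n}. {Letter (XL i), XInv i, Letter (EL i)})"

definition bmw_free :: "nat \<Rightarrow> (complex, bmw_gen list \<Rightarrow> complex) module" where
  "bmw_free n = monoid_algebra (word_monoid (bmw_gens n))"

definition bmw_rels :: "nat \<Rightarrow> (nat \<Rightarrow> nat \<Rightarrow> nat) \<Rightarrow> (nat \<Rightarrow> complex) \<Rightarrow> (nat \<Rightarrow> complex) \<Rightarrow> complex
    \<Rightarrow> ((bmw_gen list \<Rightarrow> complex) \<times> (bmw_gen list \<Rightarrow> complex)) set" where
  "bmw_rels n m k \<alpha> \<kappa> =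
    (let F = bmw_free n;
         x = (\<lambda>i. Letter (XL i));
         e = (\<lambda>i. Letter (EL i));
         q = (\<lambda>i. q_par \<kappa> (k i));
         l = (\<lambda>i. l_par \<kappa> (k i) (\<alpha> i));
         word = (\<lambda>w. delta (map Letter w))
     in
      {(delta [x i, XInv i], \<one>\<^bsub>F\<^esub>) | i. i \<in> {1..n}} \<union>
      {(delta [XInv i, x i], \<one>\<^bsub>F\<^esub>) | i. i \<in> {1..n}} \<union>
      {(delta (alt (x i) (x j) (m i j)), delta (alt (x j) (x i) (m i j))) | i j.
         i \<in> {1..n} \<and> j \<in> {1..n} \<and> i \<noteq> j} \<union>
      {((inverse (q i) - q i) \<odot>\<^bsub>F\<^esub> delta [e i], l i \<odot>\<^bsub>F\<^esub> quad F (q i) (delta [x i])) | i.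
         i \<in> {1..n}} \<union>
      {(delta [x i, e i], inverse (l i) \<odot>\<^bsub>F\<^esub> delta [e i]) | i. i \<in> {1..n}} \<union>
      {(delta [e i, x i], inverse (l i) \<odot>\<^bsub>F\<^esub> delta [e i]) | i. i \<in> {1..n}} \<union>
      {(word ([EL b] @ w @ [EL b]), bmw_Phi m k \<alpha> \<kappa> i j b w \<odot>\<^bsub>F\<^esub> delta [e b]) | i j b w.
         i \<in> {1..n} \<and> j \<in> {1..n} \<and> i < j \<and> b \<in> {i, j} \<and> w \<in> pair_words i j} \<union>
      {(word ([EL i] @ w @ [EL j]), \<zero>\<^bsub>F\<^esub>) | i j w.
         i \<in> {1..n} \<and> j \<in> {1..n} \<and> i \<noteq> j \<and> even (m i j) \<and> 2 < m i j \<and> w \<in> pair_words i j})"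

definition bmw_ideal :: "nat \<Rightarrow> (nat \<Rightarrow> nat \<Rightarrow> nat) \<Rightarrow> (nat \<Rightarrow> complex) \<Rightarrow> (nat \<Rightarrow> complex) \<Rightarrow> complex
    \<Rightarrow> (bmw_gen list \<Rightarrow> complex) set" where
  "bmw_ideal n m k \<alpha> \<kappa> = Idl\<^bsub>bmw_free n\<^esub> {r \<ominus>\<^bsub>bmw_free n\<^esub> s | r s. (r, s) \<in> bmw_rels n m k \<alpha> \<kappa>}"

definition bmw_algebra :: "nat \<Rightarrow> (nat \<Rightarrow> nat \<Rightarrow> nat) \<Rightarrow> (nat \<Rightarrow> complex) \<Rightarrow> (nat \<Rightarrow> complex) \<Rightarrow> complex
    \<Rightarrow> (complex, (bmw_gen list \<Rightarrow> complex) set) module" where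
  "bmw_algebra n m k \<alpha> \<kappa> = quot_algebra (bmw_free n) (bmw_ideal n m k \<alpha> \<kappa>)"

definition bmw_X :: "nat \<Rightarrow> (nat \<Rightarrow> nat \<Rightarrow> nat) \<Rightarrow> (nat \<Rightarrow> complex) \<Rightarrow> (nat \<Rightarrow> complex) \<Rightarrow> complex
    \<Rightarrow> nat \<Rightarrow> (bmw_gen list \<Rightarrow> complex) set" where
  "bmw_X n m k \<alpha> \<kappa> i = bmw_ideal n m k \<alpha> \<kappa> +>\<^bsub>bmw_free n\<^esub> delta [Letter (XL i)]"

definition bmw_E :: "nat \<Rightarrow> (nat \<Rightarrow> nat \<Rightarrow> nat) \<Rightarrow> (nat \<Rightarrow> complex) \<Rightarrow> (nat \<Rightarrow> complex) \<Rightarrow> complex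
    \<Rightarrow> nat \<Rightarrow> (bmw_gen list \<Rightarrow> complex) set" where
  "bmw_E n m k \<alpha> \<kappa> i = bmw_ideal n m k \<alpha> \<kappa> +>\<^bsub>bmw_free n\<^esub> delta [Letter (EL i)]"

end

theory Submission
  imports Defs
begin

text \<open>
  Every defining relation of the BMW type algebra becomes a relation of the Hecke algebra once all
  \<open>E\<^sub>i\<close> are set to zero. The relations between the \<open>X\<^sub>i\<close> alone say that they are invertible and
  satisfy the braid relations, which holds for the \<open>\<sigma>\<^sub>i\<close> already in the Artin group. The relation
  \<open>(q\<^sub>i\<inverse> - q\<^sub>i) E\<^sub>i = l\<^sub>i (X\<^sub>i - q\<^sub>i) (X\<^sub>i + q\<^sub>i\<inverse>)\<close> becomes the quadratic Hecke relation, multiplied by the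
  scalar \<open>l\<^sub>i\<close>. In every other relation both sides are multiples of words that contain some \<open>E\<^sub>i\<close>, or
  zero; so both sides vanish.

  The homomorphism is built before passing to quotients. A word in the generators is sent to zero
  if it contains some \<open>E\<^sub>i\<close>, and otherwise to the element of the Artin group that it spells
  (\<open>artin_image\<close>). This is multiplicative, so its linear extension is an algebra homomorphism from
  the free algebra to the group algebra of the Artin group (\<open>linear_ext_algebra_hom\<close>). It is
  surjective because every element of the Artin group is spelled by some word in the letters
  \<open>X\<^sub>i\<close> and \<open>X\<^sub>i\<^sup>-\<close>. It carries the relations of the BMW type algebra into the ideal of the Hecke
  algebra (\<open>artin_hom_rels\<close>), hence it induces the required surjection of the quotients
  (\<open>quot_map_hom\<close>).
\<close>

section \<open>Monoid algebras\<close>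

text \<open>The canonical pairing of a finitely supported function \<open>f\<close> with an arbitrary function \<open>\<phi>\<close>:
  the value at \<open>f\<close> of the linear functional that takes the value \<open>\<phi> x\<close> at the basis element
  \<open>delta x\<close>. Identities in a monoid algebra are proved by comparing the values of all such
  functionals (\<open>pairing_eqI\<close>). A product then turns into an iterated pairing (\<open>pairing_mult\<close>), and
  every computation with convolutions reduces to the corresponding one in the monoid.\<close>

definition pairing :: "('g \<Rightarrow> complex) \<Rightarrow> ('g \<Rightarrow> complex) \<Rightarrow> complex" where
  "pairing f \<phi> = (\<Sum>x | f x \<noteq> 0. f x * \<phi> x)"

text \<open>The linear map with value \<open>h x\<close> at the basis element \<open>delta x\<close>.\<close>

definition linear_ext :: "('g \<Rightarrow> 'h \<Rightarrow> complex) \<Rightarrow> ('g \<Rightarrow> complex) \<Rightarrow> 'h \<Rightarrow> complex" where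
  "linear_ext h f = (\<lambda>z. pairing f (\<lambda>x. h x z))"

lemma pairing_superset:
  assumes "finite A" "{x. f x \<noteq> 0} \<subseteq> A"
  shows "pairing f \<phi> = (\<Sum>x\<in>A. f x * \<phi> x)"
  unfolding pairing_def using assms by (intro sum.mono_neutral_left) auto

lemma pairing_cong:
  assumes "\<And>x. f x \<noteq> 0 \<Longrightarrow> \<phi> x = \<psi> x"
  shows "pairing f \<phi> = pairing f \<psi>"
  unfolding pairing_def using assms by (intro sum.cong) auto

lemma pairing_add_left:
  assumes "finite {x. f x \<noteq> 0}" "finite {x. g x \<noteq> 0}"
  shows "pairing (\<lambda>x. f x + g x) \<phi> = pairing f \<phi> + pairing g \<phi>"
proof -
  let ?A = "{x. f x \<noteq> 0} \<union> {x. g x \<noteq> 0}"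
  have A: "finite ?A" using assms by simp
  have "pairing (\<lambda>x. f x + g x) \<phi> = (\<Sum>x\<in>?A. (f x + g x) * \<phi> x)"
    by (rule pairing_superset[OF A]) auto
  moreover have "pairing f \<phi> = (\<Sum>x\<in>?A. f x * \<phi> x)"
    by (rule pairing_superset[OF A]) auto
  moreover have "pairing g \<phi> = (\<Sum>x\<in>?A. g x * \<phi> x)"
    by (rule pairing_superset[OF A]) auto
  ultimately show ?thesis by (simp add: distrib_right sum.distrib)
qed

lemma pairing_scale_left: "pairing (\<lambda>x. c * f x) \<phi> = c * pairing f \<phi>"
proof (cases "c = 0")
  case False
  then show ?thesis by (simp add: pairing_def sum_distrib_left mult.assoc)
qed (simp add: pairing_def)

lemma pairing_add_right: "pairing f (\<lambda>x. \<phi> x + \<psi> x) = pairing f \<phi> + pairing f \<psi>"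
  by (simp add: pairing_def distrib_left sum.distrib)

lemma pairing_delta [simp]: "pairing (delta x) \<phi> = \<phi> x"
proof -
  have "{z. delta x z \<noteq> 0} = {x}" by (auto simp: delta_def)
  then show ?thesis by (simp add: pairing_def delta_def)
qed

lemma pairing_swap:
  "pairing f (\<lambda>x. pairing g (\<lambda>y. \<phi> x y)) = pairing g (\<lambda>y. pairing f (\<lambda>x. \<phi> x y))"
  unfolding pairing_def sum_distrib_left
  by (subst sum.swap) (simp add: mult.left_commute)

text \<open>The functionals separate points because the indicator function of a point \<open>z\<close> yields the
  evaluation at \<open>z\<close>.\<close>

lemma pairing_eqI:
  assumes "finite {x. f x \<noteq> 0}" "finite {x. g x \<noteq> 0}" "\<And>\<phi>. pairing f \<phi> = pairing g \<phi>"
  shows "f = g"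
proof
  fix z
  have "pairing f' (\<lambda>x. if x = z then 1 else 0) = f' z" if "finite {x. f' x \<noteq> 0}"
    for f' :: "'a \<Rightarrow> complex"
  proof -
    have "pairing f' (\<lambda>x. if x = z then 1 else 0)
        = (\<Sum>x\<in>insert z {x. f' x \<noteq> 0}. f' x * (if x = z then 1 else 0))"
      by (rule pairing_superset) (use that in auto)
    also have "\<dots> = (\<Sum>x\<in>insert z {x. f' x \<noteq> 0}. if x = z then f' x else 0)"
      by (intro sum.cong) auto
    also have "\<dots> = f' z" by (subst sum.delta) (use that in auto)
    finally show ?thesis .
  qed
  then show "f z = g z" using assms by metis
qed

lemma linear_ext_support: "{z. linear_ext h f z \<noteq> 0} \<subseteq> (\<Union>x\<in>{x. f x \<noteq> 0}. {z. h x z \<noteq> 0})"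
proof -
  have "\<exists>x. f x \<noteq> 0 \<and> h x z \<noteq> 0" if z: "linear_ext h f z \<noteq> 0" for z
  proof (rule ccontr)
    assume "\<not> ?thesis"
    then have "linear_ext h f z = 0" unfolding linear_ext_def pairing_def by (intro sum.neutral) auto
    with z show False by simp
  qed
  then show ?thesis by blast
qed

lemma linear_ext_finite:
  assumes "finite {x. f x \<noteq> 0}" "\<And>x. f x \<noteq> 0 \<Longrightarrow> finite {z. h x z \<noteq> 0}"
  shows "finite {z. linear_ext h f z \<noteq> 0}"
  by (rule finite_subset[OF linear_ext_support]) (use assms in auto)

text \<open>Composing a functional with a linear map: both sides are the same finite double sum over the
  union of the supports of the values \<open>h x\<close>.\<close>

lemma pairing_linear_ext:
  assumes "finite {x. f x \<noteq> 0}" "\<And>x. f x \<noteq> 0 \<Longrightarrow> finite {z. h x z \<noteq> 0}"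
  shows "pairing (linear_ext h f) \<phi> = pairing f (\<lambda>x. pairing (h x) \<phi>)"
proof -
  let ?U = "\<Union>x\<in>{x. f x \<noteq> 0}. {z. h x z \<noteq> 0}"
  have U: "finite ?U" using assms by auto
  have "pairing (linear_ext h f) \<phi> = (\<Sum>z\<in>?U. linear_ext h f z * \<phi> z)"
    by (rule pairing_superset[OF U linear_ext_support])
  also have "\<dots> = (\<Sum>x | f x \<noteq> 0. f x * (\<Sum>z\<in>?U. h x z * \<phi> z))"
    unfolding linear_ext_def pairing_def sum_distrib_right sum_distrib_left mult.assoc
    by (rule sum.swap)
  also have "\<dots> = (\<Sum>x | f x \<noteq> 0. f x * pairing (h x) \<phi>)"
  proof (rule sum.cong[OF HOL.refl])
    fix x assume x: "x \<in> {x. f x \<noteq> 0}"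
    have "pairing (h x) \<phi> = (\<Sum>z\<in>?U. h x z * \<phi> z)"
      by (rule pairing_superset[OF U]) (use x in blast)
    then show "f x * (\<Sum>z\<in>?U. h x z * \<phi> z) = f x * pairing (h x) \<phi>" by simp
  qed
  finally show ?thesis unfolding pairing_def[of f] .
qed

lemma linear_ext_delta [simp]: "linear_ext h (delta x) = h x"
  by (simp add: linear_ext_def)

lemma delta_finite [simp]: "finite {z. delta x z \<noteq> 0}"
  unfolding delta_def by simp

lemma monoid_algebra_carrier:
  "f \<in> carrier (monoid_algebra G) \<longleftrightarrow> finite {x. f x \<noteq> 0} \<and> {x. f x \<noteq> 0} \<subseteq> carrier G"
  by (simp add: monoid_algebra_def)

lemma monoid_algebra_finite: "f \<in> carrier (monoid_algebra G) \<Longrightarrow> finite {x. f x \<noteq> 0}"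
  by (simp add: monoid_algebra_carrier)

lemma monoid_algebra_supportD:
  "f \<in> carrier (monoid_algebra G) \<Longrightarrow> f x \<noteq> 0 \<Longrightarrow> x \<in> carrier G"
  by (auto simp: monoid_algebra_carrier)

lemma delta_carrier [simp]: "x \<in> carrier G \<Longrightarrow> delta x \<in> carrier (monoid_algebra G)"
  by (auto simp: monoid_algebra_carrier) (auto simp: delta_def split: if_splits)

lemma monoid_algebra_one: "\<one>\<^bsub>monoid_algebra G\<^esub> = delta \<one>\<^bsub>G\<^esub>"
  by (simp add: monoid_algebra_def delta_def)

lemma monoid_algebra_zero: "\<zero>\<^bsub>monoid_algebra G\<^esub> = (\<lambda>z. 0)"
  by (simp add: monoid_algebra_def)

lemma monoid_algebra_add: "f \<oplus>\<^bsub>monoid_algebra G\<^esub> g = (\<lambda>z. f z + g z)"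
  by (simp add: monoid_algebra_def)

lemma monoid_algebra_smult: "c \<odot>\<^bsub>monoid_algebra G\<^esub> f = (\<lambda>z. c * f z)"
  by (simp add: monoid_algebra_def)

text \<open>Convolution is the bilinear extension of the multiplication of the monoid. This form brings
  the double sum of the definition under the rules for \<open>linear_ext\<close>.\<close>

lemma monoid_algebra_mult:
  "f \<otimes>\<^bsub>monoid_algebra G\<^esub> g = linear_ext (\<lambda>x. linear_ext (\<lambda>y. delta (x \<otimes>\<^bsub>G\<^esub> y)) g) f"
  unfolding monoid_algebra_def linear_ext_def pairing_def delta_def sum_distrib_left
  by (auto intro!: ext sum.cong)

lemma monoid_algebra_mult_finite:
  assumes "finite {x. f x \<noteq> 0}" "finite {x. g x \<noteq> 0}"
  shows "finite {z. (f \<otimes>\<^bsub>monoid_algebra G\<^esub> g) z \<noteq> 0}"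
  unfolding monoid_algebra_mult by (intro linear_ext_finite assms delta_finite)

lemma pairing_mult:
  assumes "finite {x. f x \<noteq> 0}" "finite {x. g x \<noteq> 0}"
  shows "pairing (f \<otimes>\<^bsub>monoid_algebra G\<^esub> g) \<phi> = pairing f (\<lambda>x. pairing g (\<lambda>y. \<phi> (x \<otimes>\<^bsub>G\<^esub> y)))"
  unfolding monoid_algebra_mult
  by (simp add: pairing_linear_ext linear_ext_finite assms)

lemma delta_mult: "delta x \<otimes>\<^bsub>monoid_algebra G\<^esub> delta y = delta (x \<otimes>\<^bsub>G\<^esub> y)"
  by (simp add: monoid_algebra_mult)

lemma linear_ext_carrier:
  assumes "f \<in> carrier (monoid_algebra G)" "\<And>x. x \<in> carrier G \<Longrightarrow> h x \<in> carrier (monoid_algebra G')"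
  shows "linear_ext h f \<in> carrier (monoid_algebra G')"
proof -
  have h: "h x \<in> carrier (monoid_algebra G')" if "f x \<noteq> 0" for x
    using that assms monoid_algebra_supportD by metis
  have "finite {z. linear_ext h f z \<noteq> 0}"
    using assms(1) h by (intro linear_ext_finite) (auto dest: monoid_algebra_finite)
  moreover have "{z. linear_ext h f z \<noteq> 0} \<subseteq> carrier G'"
    using linear_ext_support[of h f] h monoid_algebra_supportD by fastforce
  ultimately show ?thesis by (simp add: monoid_algebra_carrier)
qed

lemma monoid_algebra_add_closed:
  assumes "f \<in> carrier (monoid_algebra G)" "g \<in> carrier (monoid_algebra G)"
  shows "(\<lambda>z. f z + g z) \<in> carrier (monoid_algebra G)"
proof -
  have sub: "{z. f z + g z \<noteq> 0} \<subseteq> {z. f z \<noteq> 0} \<union> {z. g z \<noteq> 0}" by auto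
  have "finite {z. f z + g z \<noteq> 0}" by (rule finite_subset[OF sub]) (simp add: assms[THEN monoid_algebra_finite])
  moreover have "{z. f z + g z \<noteq> 0} \<subseteq> carrier G"
    using sub assms by (auto simp: monoid_algebra_carrier)
  ultimately show ?thesis by (simp add: monoid_algebra_carrier)
qed

lemma monoid_algebra_smult_closed:
  assumes "f \<in> carrier (monoid_algebra G)"
  shows "(\<lambda>z. c * f z) \<in> carrier (monoid_algebra G)"
  using assms by (auto simp: monoid_algebra_carrier elim: rev_finite_subset)

declare monoid_algebra_finite [simp]

context monoid begin

lemma monoid_algebra_ring: "ring (monoid_algebra G)"
proof (rule ringI)
  let ?A = "monoid_algebra G"
  show "abelian_group ?A"
  proof (rule abelian_groupI)
    fix f assume f: "f \<in> carrier ?A"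
    show "\<exists>g\<in>carrier ?A. g \<oplus>\<^bsub>?A\<^esub> f = \<zero>\<^bsub>?A\<^esub>"
      by (rule bexI[OF _ monoid_algebra_smult_closed[OF f, of "-1"]])
         (simp add: monoid_algebra_add monoid_algebra_zero)
  qed (auto simp: monoid_algebra_add monoid_algebra_zero monoid_algebra_add_closed,
       auto simp: monoid_algebra_carrier)
  have mult_closed: "f \<otimes>\<^bsub>?A\<^esub> g \<in> carrier ?A" if "f \<in> carrier ?A" "g \<in> carrier ?A" for f g
    unfolding monoid_algebra_mult using that by (intro linear_ext_carrier) auto
  show "monoid ?A"
  proof (rule monoidI)
    fix f g h assume f: "f \<in> carrier ?A" and g: "g \<in> carrier ?A" and h: "h \<in> carrier ?A"
    show "f \<otimes>\<^bsub>?A\<^esub> g \<otimes>\<^bsub>?A\<^esub> h = f \<otimes>\<^bsub>?A\<^esub> (g \<otimes>\<^bsub>?A\<^esub> h)"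
    proof (rule pairing_eqI)
      fix \<phi>
      have "pairing f (\<lambda>x. pairing g (\<lambda>y. pairing h (\<lambda>z. \<phi> (x \<otimes> y \<otimes> z))))
          = pairing f (\<lambda>x. pairing g (\<lambda>y. pairing h (\<lambda>z. \<phi> (x \<otimes> (y \<otimes> z)))))"
        using f g h by (intro pairing_cong) (simp add: m_assoc monoid_algebra_supportD)
      then show "pairing (f \<otimes>\<^bsub>?A\<^esub> g \<otimes>\<^bsub>?A\<^esub> h) \<phi> = pairing (f \<otimes>\<^bsub>?A\<^esub> (g \<otimes>\<^bsub>?A\<^esub> h)) \<phi>"
        using f g h by (simp add: pairing_mult monoid_algebra_mult_finite)
    qed (use f g h in \<open>simp_all add: monoid_algebra_mult_finite\<close>)
  next
    fix f assume f: "f \<in> carrier ?A"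
    show "\<one>\<^bsub>?A\<^esub> \<otimes>\<^bsub>?A\<^esub> f = f"
    proof (rule pairing_eqI)
      fix \<phi>
      have "pairing f (\<lambda>x. \<phi> (\<one> \<otimes> x)) = pairing f \<phi>"
        using f by (intro pairing_cong) (simp add: monoid_algebra_supportD)
      then show "pairing (\<one>\<^bsub>?A\<^esub> \<otimes>\<^bsub>?A\<^esub> f) \<phi> = pairing f \<phi>"
        using f by (simp add: pairing_mult monoid_algebra_one)
    qed (use f in \<open>simp_all add: monoid_algebra_mult_finite monoid_algebra_one\<close>)
    show "f \<otimes>\<^bsub>?A\<^esub> \<one>\<^bsub>?A\<^esub> = f"
    proof (rule pairing_eqI)
      fix \<phi>
      have "pairing f (\<lambda>x. \<phi> (x \<otimes> \<one>)) = pairing f \<phi>"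
        using f by (intro pairing_cong) (simp add: monoid_algebra_supportD)
      then show "pairing (f \<otimes>\<^bsub>?A\<^esub> \<one>\<^bsub>?A\<^esub>) \<phi> = pairing f \<phi>"
        using f by (simp add: pairing_mult monoid_algebra_one)
    qed (use f in \<open>simp_all add: monoid_algebra_mult_finite monoid_algebra_one\<close>)
  qed (auto simp: mult_closed monoid_algebra_one)
next
  let ?A = "monoid_algebra G"
  fix f g h assume f: "f \<in> carrier ?A" and g: "g \<in> carrier ?A" and h: "h \<in> carrier ?A"
  show "(f \<oplus>\<^bsub>?A\<^esub> g) \<otimes>\<^bsub>?A\<^esub> h = f \<otimes>\<^bsub>?A\<^esub> h \<oplus>\<^bsub>?A\<^esub> g \<otimes>\<^bsub>?A\<^esub> h"
    unfolding monoid_algebra_add monoid_algebra_mult linear_ext_def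
    using f g by (simp add: pairing_add_left)
  show "h \<otimes>\<^bsub>?A\<^esub> (f \<oplus>\<^bsub>?A\<^esub> g) = h \<otimes>\<^bsub>?A\<^esub> f \<oplus>\<^bsub>?A\<^esub> h \<otimes>\<^bsub>?A\<^esub> g"
    unfolding monoid_algebra_add monoid_algebra_mult linear_ext_def
    using f g by (simp add: pairing_add_left pairing_add_right)
qed

text \<open>A scalar acts as left multiplication by the corresponding multiple of one. It
  follows that every ideal is a linear subspace.\<close>

lemma monoid_algebra_smult_one_mult:
  assumes "f \<in> carrier (monoid_algebra G)"
  shows "c \<odot>\<^bsub>monoid_algebra G\<^esub> f = (c \<odot>\<^bsub>monoid_algebra G\<^esub> \<one>\<^bsub>monoid_algebra G\<^esub>) \<otimes>\<^bsub>monoid_algebra G\<^esub> f"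
proof -
  interpret A: ring "monoid_algebra G" by (rule monoid_algebra_ring)
  have "(c \<odot>\<^bsub>monoid_algebra G\<^esub> \<one>\<^bsub>monoid_algebra G\<^esub>) \<otimes>\<^bsub>monoid_algebra G\<^esub> f
      = c \<odot>\<^bsub>monoid_algebra G\<^esub> (\<one>\<^bsub>monoid_algebra G\<^esub> \<otimes>\<^bsub>monoid_algebra G\<^esub> f)"
    unfolding monoid_algebra_smult monoid_algebra_mult linear_ext_def
    by (simp add: pairing_scale_left)
  with assms show ?thesis by simp
qed

end

text \<open>The universal property of the monoid algebra, for multiplicative maps into another monoid
  algebra. The values \<open>h x\<close> may be arbitrary elements and not just basis elements, so that \<open>h\<close> can
  send part of the monoid to zero.\<close>

lemma linear_ext_algebra_hom:
  assumes "monoid G" "monoid G'"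
    and h: "\<And>x. x \<in> carrier G \<Longrightarrow> h x \<in> carrier (monoid_algebra G')"
    and one: "h \<one>\<^bsub>G\<^esub> = \<one>\<^bsub>monoid_algebra G'\<^esub>"
    and mult: "\<And>x y. x \<in> carrier G \<Longrightarrow> y \<in> carrier G
        \<Longrightarrow> h (x \<otimes>\<^bsub>G\<^esub> y) = h x \<otimes>\<^bsub>monoid_algebra G'\<^esub> h y"
  shows "linear_ext h \<in> algebra_hom (monoid_algebra G) (monoid_algebra G')"
  unfolding algebra_hom_def
proof (intro CollectI conjI allI ballI ring_hom_memI)
  let ?A = "monoid_algebra G" and ?B = "monoid_algebra G'"
  interpret A: ring ?A by (rule monoid.monoid_algebra_ring[OF assms(1)])
  fix f assume f: "f \<in> carrier ?A"
  then show "linear_ext h f \<in> carrier ?B" by (rule linear_ext_carrier[OF _ h])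
  show "linear_ext h (c \<odot>\<^bsub>?A\<^esub> f) = c \<odot>\<^bsub>?B\<^esub> linear_ext h f" for c
    by (simp add: linear_ext_def monoid_algebra_smult pairing_scale_left)
  fix g assume g: "g \<in> carrier ?A"
  show "linear_ext h (f \<oplus>\<^bsub>?A\<^esub> g) = linear_ext h f \<oplus>\<^bsub>?B\<^esub> linear_ext h g"
    using f g by (simp add: linear_ext_def monoid_algebra_add pairing_add_left)
  have fin: "finite {z. h x z \<noteq> 0}" if "u x \<noteq> 0" "u \<in> carrier ?A" for u x
    using h[OF monoid_algebra_supportD[OF that(2,1)]] by simp
  have pair: "pairing (linear_ext h u) \<phi> = pairing u (\<lambda>x. pairing (h x) \<phi>)"
    if "u \<in> carrier ?A" for u \<phi>
    using fin that by (intro pairing_linear_ext) auto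
  show "linear_ext h (f \<otimes>\<^bsub>?A\<^esub> g) = linear_ext h f \<otimes>\<^bsub>?B\<^esub> linear_ext h g"
  proof (rule pairing_eqI)
    have closed: "linear_ext h u \<in> carrier ?B" if "u \<in> carrier ?A" for u
      using that h by (rule linear_ext_carrier)
    show "finite {z. linear_ext h (f \<otimes>\<^bsub>?A\<^esub> g) z \<noteq> 0}"
      using closed[OF A.m_closed[OF f g]] by simp
    show "finite {z. (linear_ext h f \<otimes>\<^bsub>?B\<^esub> linear_ext h g) z \<noteq> 0}"
      using closed[OF f] closed[OF g] by (simp add: monoid_algebra_mult_finite)
    fix \<phi>
    have "pairing (linear_ext h (f \<otimes>\<^bsub>?A\<^esub> g)) \<phi>
        = pairing f (\<lambda>x. pairing g (\<lambda>y. pairing (h (x \<otimes>\<^bsub>G\<^esub> y)) \<phi>))"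
      using f g by (simp add: pair pairing_mult)
    also have "\<dots> = pairing f (\<lambda>x. pairing g (\<lambda>y. pairing (h x) (\<lambda>u. pairing (h y) (\<lambda>v. \<phi> (u \<otimes>\<^bsub>G'\<^esub> v)))))"
      using f g by (intro pairing_cong) (simp add: mult pairing_mult fin monoid_algebra_supportD)
    also have "\<dots> = pairing f (\<lambda>x. pairing (h x) (\<lambda>u. pairing g (\<lambda>y. pairing (h y) (\<lambda>v. \<phi> (u \<otimes>\<^bsub>G'\<^esub> v)))))"
      by (subst (2) pairing_swap) (rule HOL.refl)
    also have "\<dots> = pairing (linear_ext h f \<otimes>\<^bsub>?B\<^esub> linear_ext h g) \<phi>"
      using f g by (simp add: pair pairing_mult closed[THEN monoid_algebra_finite])
    finally show "pairing (linear_ext h (f \<otimes>\<^bsub>?A\<^esub> g)) \<phi> = pairing (linear_ext h f \<otimes>\<^bsub>?B\<^esub> linear_ext h g) \<phi>" .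
  qed
qed (simp add: monoid_algebra_one one)

text \<open>A choice \<open>s\<close> of preimages of the basis elements extends to a linear right inverse; it need not
  be multiplicative.\<close>

lemma linear_ext_surj:
  assumes h: "\<And>x. x \<in> carrier G \<Longrightarrow> h x \<in> carrier (monoid_algebra G')"
    and deltas: "\<And>y. y \<in> carrier G' \<Longrightarrow> \<exists>x\<in>carrier G. h x = delta y"
  shows "linear_ext h ` carrier (monoid_algebra G) = carrier (monoid_algebra G')"
proof (intro equalityI subsetI)
  fix g assume g: "g \<in> carrier (monoid_algebra G')"
  from deltas obtain s where s: "s y \<in> carrier G" "h (s y) = delta y" if "y \<in> carrier G'" for y
    by metis
  let ?f = "linear_ext (\<lambda>y. delta (s y)) g"
  have f: "?f \<in> carrier (monoid_algebra G)"
    using g by (rule linear_ext_carrier) (simp add: s)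
  have "linear_ext h ?f = g"
  proof (rule pairing_eqI)
    show "finite {z. linear_ext h ?f z \<noteq> 0}"
      by (rule monoid_algebra_finite[of _ G'], rule linear_ext_carrier[OF f]) (rule h)
    fix \<phi>
    have "finite {z. h x z \<noteq> 0}" if "?f x \<noteq> 0" for x
      using h[OF monoid_algebra_supportD[OF f that]] by simp
    then have "pairing (linear_ext h ?f) \<phi> = pairing ?f (\<lambda>x. pairing (h x) \<phi>)"
      using f by (intro pairing_linear_ext) auto
    also have "\<dots> = pairing g (\<lambda>y. pairing (h (s y)) \<phi>)"
      using g by (simp add: pairing_linear_ext)
    also have "\<dots> = pairing g \<phi>"
      using g by (intro pairing_cong) (simp add: s monoid_algebra_supportD)
    finally show "pairing (linear_ext h ?f) \<phi> = pairing g \<phi>" .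
  qed (use g in simp)
  with f show "g \<in> linear_ext h ` carrier (monoid_algebra G)" by (metis image_eqI)
next
  fix g assume "g \<in> linear_ext h ` carrier (monoid_algebra G)"
  then obtain f where f: "f \<in> carrier (monoid_algebra G)" and g: "g = linear_ext h f" by blast
  from f show "g \<in> carrier (monoid_algebra G')" unfolding g by (rule linear_ext_carrier) (rule h)
qed

section \<open>Word monoids and presented groups\<close>

lemma word_monoid_monoid: "monoid (word_monoid S)"
  by (rule monoidI) (auto simp: word_monoid_def)

lemma pres_eq_gwords:
  assumes "pres_eq S R u v"
  shows "u \<in> gwords S \<and> v \<in> gwords S"
  using assms by induction auto

lemma pres_eq_append:
  assumes "pres_eq S R u v" "a \<in> gwords S" "b \<in> gwords S"
  shows "pres_eq S R (a @ u @ b) (a @ v @ b)"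
  using assms
proof (induction rule: pres_eq.induct)
  case (cancel s u v c)
  then have "pres_eq S R ((a @ u) @ [(s, c), (s, \<not> c)] @ (v @ b)) ((a @ u) @ (v @ b))"
    by (intro pres_eq.cancel) auto
  then show ?case by simp
next
  case (rel r s u v)
  then have "pres_eq S R ((a @ u) @ r @ (v @ b)) ((a @ u) @ s @ (v @ b))"
    by (intro pres_eq.rel) auto
  then show ?case by simp
next
  case (refl w)
  then show ?case by (intro pres_eq.refl) auto
qed (auto intro: pres_eq.sym pres_eq.trans)

lemma pres_class_eq:
  assumes "pres_eq S R u v"
  shows "pres_class S R u = pres_class S R v"
  using assms by (auto simp: pres_class_def intro: pres_eq.sym pres_eq.trans)

text \<open>The product of two classes is defined as a union over all their representatives. It is a
  single class since the equivalence is compatible with concatenation on both sides.\<close>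

lemma presented_group_mult:
  assumes "u \<in> gwords S" "v \<in> gwords S"
  shows "pres_class S R u \<otimes>\<^bsub>presented_group S R\<^esub> pres_class S R v = pres_class S R (u @ v)"
proof -
  have "pres_class S R (u' @ v') = pres_class S R (u @ v)"
    if "pres_eq S R u u'" "pres_eq S R v v'" for u' v'
  proof -
    have "pres_eq S R (u @ v) (u' @ v)"
      using pres_eq_append[OF that(1), of "[]" v] assms by simp
    moreover have "pres_eq S R (u' @ v) (u' @ v')"
      using pres_eq_append[OF that(2), of u' "[]"] pres_eq_gwords[OF that(1)] by simp
    ultimately show ?thesis by (metis pres_class_eq pres_eq.trans)
  qed
  moreover have "u \<in> pres_class S R u" "v \<in> pres_class S R v"
    unfolding pres_class_def using assms by (blast intro: pres_eq.refl)+
  ultimately have "(\<Union>u'\<in>pres_class S R u. \<Union>v'\<in>pres_class S R v. pres_class S R (u' @ v'))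
      = pres_class S R (u @ v)"
    unfolding pres_class_def[of S R u] pres_class_def[of S R v] by blast
  then show ?thesis by (simp add: presented_group_def)
qed

lemma presented_group_carrier: "carrier (presented_group S R) = pres_class S R ` gwords S"
  and presented_group_one: "\<one>\<^bsub>presented_group S R\<^esub> = pres_class S R []"
  by (simp_all add: presented_group_def)

lemma presented_group_monoid: "monoid (presented_group S R)"
proof (rule monoidI)
  let ?G = "presented_group S R"
  have nil: "[] \<in> gwords S" by simp
  note mult = presented_group_mult[of _ S _ R]
  show "\<one>\<^bsub>?G\<^esub> \<in> carrier ?G"
    unfolding presented_group_carrier presented_group_one by (rule imageI[OF nil])
  fix A assume "A \<in> carrier ?G"
  then obtain a where a: "a \<in> gwords S" "A = pres_class S R a" by (auto simp: presented_group_carrier)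
  show "\<one>\<^bsub>?G\<^esub> \<otimes>\<^bsub>?G\<^esub> A = A" "A \<otimes>\<^bsub>?G\<^esub> \<one>\<^bsub>?G\<^esub> = A"
    unfolding presented_group_one a(2) mult[OF nil a(1)] mult[OF a(1) nil] by simp_all
  fix B assume "B \<in> carrier ?G"
  then obtain b where b: "b \<in> gwords S" "B = pres_class S R b" by (auto simp: presented_group_carrier)
  have ab: "a @ b \<in> gwords S" using a(1) b(1) by simp
  show "A \<otimes>\<^bsub>?G\<^esub> B \<in> carrier ?G"
    unfolding a(2) b(2) mult[OF a(1) b(1)] presented_group_carrier by (rule imageI[OF ab])
  fix C assume "C \<in> carrier ?G"
  then obtain c where c: "c \<in> gwords S" "C = pres_class S R c" by (auto simp: presented_group_carrier)
  have bc: "b @ c \<in> gwords S" using b(1) c(1) by simp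
  show "A \<otimes>\<^bsub>?G\<^esub> B \<otimes>\<^bsub>?G\<^esub> C = A \<otimes>\<^bsub>?G\<^esub> (B \<otimes>\<^bsub>?G\<^esub> C)"
    unfolding a(2) b(2) c(2) mult[OF a(1) b(1)] mult[OF b(1) c(1)] mult[OF ab c(1)] mult[OF a(1) bc]
    by simp
qed

section \<open>Homomorphisms between quotient algebras\<close>

text \<open>The map of quotients induced by \<open>\<phi>\<close>. If \<open>\<phi>\<close> maps \<open>I\<close> into \<open>J\<close>, all cosets in the union over the
  representatives \<open>y\<close> of a coset of \<open>I\<close> coincide, so that no representative has to be chosen.\<close>

definition quot_map :: "(complex, 'b) module \<Rightarrow> 'b set \<Rightarrow> ('a \<Rightarrow> 'b) \<Rightarrow> 'a set \<Rightarrow> 'b set" where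
  "quot_map B J \<phi> Y = (\<Union>y\<in>Y. J +>\<^bsub>B\<^esub> \<phi> y)"

text \<open>A ring with an action of the complex numbers by left multiplication with the multiples of one.
  This is the part of the structure of an algebra that makes the scalars act on every
  quotient by an ideal.\<close>

locale scalar_ring = ring A for A :: "(complex, 'a) module" (structure) +
  assumes smult_one_closed: "c \<odot> \<one> \<in> carrier A"
    and smult_eq: "x \<in> carrier A \<Longrightarrow> c \<odot> x = (c \<odot> \<one>) \<otimes> x"
begin

lemma smult_closed: "x \<in> carrier A \<Longrightarrow> c \<odot> x \<in> carrier A"
  by (subst smult_eq) (auto simp: smult_one_closed)

lemma quot_algebra_carrier:
  assumes "ideal I A"
  shows "carrier (quot_algebra A I) = (\<lambda>x. I +> x) ` carrier A"
  by (auto simp: quot_algebra_def FactRing_def A_RCOSETS_def')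

lemma coset_UN_eq:
  assumes "ideal I A" "x \<in> carrier A"
    and "\<And>y. y \<in> I +> x \<Longrightarrow> F y = F x"
  shows "(\<Union>y\<in>I +> x. F y) = F x"
proof -
  interpret I: ideal I A by fact
  have "x \<in> I +> x" using assms(2) by (rule I.a_rcos_self)
  with assms(3) show ?thesis by blast
qed

lemma quot_algebra_smult:
  assumes I: "ideal I A" and x: "x \<in> carrier A"
  shows "c \<odot>\<^bsub>quot_algebra A I\<^esub> (I +> x) = I +> (c \<odot> x)"
proof -
  interpret I: ideal I A by (rule I)
  have "I +> (c \<odot> y) = I +> (c \<odot> x)" if "y \<in> I +> x" for y
  proof -
    from that obtain i where i: "i \<in> I" "y = i \<oplus> x" by (auto simp: a_r_coset_def')
    have "c \<odot> y = (c \<odot> \<one>) \<otimes> i \<oplus> c \<odot> x"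
      using i x smult_one_closed I.Icarr by (simp add: smult_eq[of "i \<oplus> x"] smult_eq[of x] r_distr)
    then have "c \<odot> y \<in> I +> (c \<odot> x)"
      using i smult_one_closed I.I_l_closed by (auto simp: a_r_coset_def')
    then show ?thesis using I.a_repr_independence' smult_closed x by metis
  qed
  then show ?thesis
    using coset_UN_eq[OF I x, of "\<lambda>y. I +> (c \<odot> y)"] by (simp add: quot_algebra_def)
qed

lemma quad_hom:
  assumes \<phi>: "\<phi> \<in> algebra_hom A B" and B: "ring B" and x: "x \<in> carrier A"
  shows "\<phi> (quad A q x) = quad B q (\<phi> x)"
proof -
  interpret hom: ring_hom_ring A B \<phi>
    using \<phi> B by (auto simp: algebra_hom_def intro!: ring_hom_ringI2 ring_axioms)
  have "\<phi> (c \<odot> \<one>) = c \<odot>\<^bsub>B\<^esub> \<one>\<^bsub>B\<^esub>" for c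
    using \<phi> by (auto simp: algebra_hom_def)
  then show ?thesis
    using x smult_one_closed by (simp add: quad_def a_minus_def)
qed

end

lemma quot_map_hom:
  assumes A: "scalar_ring A" and B: "scalar_ring B" and I: "ideal I A" and J: "ideal J B"
    and \<phi>: "\<phi> \<in> algebra_hom A B" and IJ: "\<phi> ` I \<subseteq> J"
  shows quot_map_coset: "x \<in> carrier A \<Longrightarrow> quot_map B J \<phi> (I +>\<^bsub>A\<^esub> x) = J +>\<^bsub>B\<^esub> \<phi> x"
    and quot_map_algebra_hom: "quot_map B J \<phi> \<in> algebra_hom (quot_algebra A I) (quot_algebra B J)"
proof -
  interpret A: scalar_ring A by (rule A)
  interpret B: scalar_ring B by (rule B)
  interpret I: ideal I A by (rule I)
  interpret J: ideal J B by (rule J)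
  interpret hom: ring_hom_ring A B \<phi>
    using \<phi> by (auto simp: algebra_hom_def intro!: ring_hom_ringI2 A.ring_axioms B.ring_axioms)
  show coset: "quot_map B J \<phi> (I +>\<^bsub>A\<^esub> x) = J +>\<^bsub>B\<^esub> \<phi> x" if x: "x \<in> carrier A" for x
    unfolding quot_map_def
  proof (rule A.coset_UN_eq[OF I x])
    fix y assume "y \<in> I +>\<^bsub>A\<^esub> x"
    then obtain i where i: "i \<in> I" "y = i \<oplus>\<^bsub>A\<^esub> x" by (auto simp: a_r_coset_def')
    then have "\<phi> y = \<phi> i \<oplus>\<^bsub>B\<^esub> \<phi> x" using x I.Icarr by simp
    then have "\<phi> y \<in> J +>\<^bsub>B\<^esub> \<phi> x" using i IJ by (auto simp: a_r_coset_def')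
    then show "J +>\<^bsub>B\<^esub> \<phi> y = J +>\<^bsub>B\<^esub> \<phi> x"
      using J.a_repr_independence' x hom.hom_closed by metis
  qed
  show "quot_map B J \<phi> \<in> algebra_hom (quot_algebra A I) (quot_algebra B J)"
    unfolding algebra_hom_def
  proof (intro CollectI conjI allI ballI ring_hom_memI)
    fix X assume "X \<in> carrier (quot_algebra A I)"
    then obtain x where x: "x \<in> carrier A" "X = I +>\<^bsub>A\<^esub> x" by (auto simp: A.quot_algebra_carrier[OF I])
    show "quot_map B J \<phi> X \<in> carrier (quot_algebra B J)"
      using x by (auto simp: coset B.quot_algebra_carrier[OF J])
    show "quot_map B J \<phi> (c \<odot>\<^bsub>quot_algebra A I\<^esub> X) = c \<odot>\<^bsub>quot_algebra B J\<^esub> quot_map B J \<phi> X" for c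
      using x \<phi> by (simp add: A.quot_algebra_smult[OF I] B.quot_algebra_smult[OF J] coset
          A.smult_closed algebra_hom_def)
    fix Y assume "Y \<in> carrier (quot_algebra A I)"
    then obtain y where y: "y \<in> carrier A" "Y = I +>\<^bsub>A\<^esub> y" by (auto simp: A.quot_algebra_carrier[OF I])
    show "quot_map B J \<phi> (X \<otimes>\<^bsub>quot_algebra A I\<^esub> Y)
        = quot_map B J \<phi> X \<otimes>\<^bsub>quot_algebra B J\<^esub> quot_map B J \<phi> Y"
      using x y by (simp add: quot_algebra_def FactRing_def I.rcoset_mult_add J.rcoset_mult_add coset)
    show "quot_map B J \<phi> (X \<oplus>\<^bsub>quot_algebra A I\<^esub> Y)
        = quot_map B J \<phi> X \<oplus>\<^bsub>quot_algebra B J\<^esub> quot_map B J \<phi> Y"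
      using x y by (simp add: quot_algebra_def FactRing_def I.a_rcos_sum J.a_rcos_sum coset)
  next
    show "quot_map B J \<phi> \<one>\<^bsub>quot_algebra A I\<^esub> = \<one>\<^bsub>quot_algebra B J\<^esub>"
      by (simp add: quot_algebra_def FactRing_def coset)
  qed
qed

lemma monoid_algebra_scalar_ring:
  assumes "monoid G"
  shows "scalar_ring (monoid_algebra G)"
proof -
  interpret G: monoid G by fact
  show ?thesis
    using G.monoid_algebra_ring
    by (auto simp: scalar_ring_def scalar_ring_axioms_def monoid_algebra_smult[symmetric]
        monoid_algebra_one intro: G.monoid_algebra_smult_one_mult[unfolded monoid_algebra_one])
       (simp add: monoid_algebra_smult monoid_algebra_smult_closed)
qed

section \<open>From the BMW type algebra to the Hecke algebra\<close>

text \<open>The value at the letters \<open>E\<^sub>i\<close> is a dummy: words containing such a letter are sent to zero.\<close>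

primrec artin_letter :: "bmw_gen \<Rightarrow> nat \<times> bool" where
  "artin_letter (Letter x) = (case x of XL i \<Rightarrow> (i, True) | EL i \<Rightarrow> (i, True))"
| "artin_letter (XInv i) = (i, False)"

definition artin_image :: "nat \<Rightarrow> (nat \<Rightarrow> nat \<Rightarrow> nat) \<Rightarrow> bmw_gen list \<Rightarrow> nat gword set \<Rightarrow> complex" where
  "artin_image n m w = (if \<exists>i. Letter (EL i) \<in> set w then \<zero>\<^bsub>artin_algebra n m\<^esub>
     else delta (pres_class {1..n} (artin_rels n m) (map artin_letter w)))"

lemma artin_letter_gwords:
  assumes "w \<in> lists (bmw_gens n)"
  shows "map artin_letter w \<in> gwords {1..n}"
  using assms by (induction w) (auto simp: bmw_gens_def)

lemma artin_algebra_scalar_ring: "scalar_ring (artin_algebra n m)"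
  unfolding artin_group_def by (intro monoid_algebra_scalar_ring presented_group_monoid)

lemma bmw_free_scalar_ring: "scalar_ring (bmw_free n)"
  unfolding bmw_free_def by (intro monoid_algebra_scalar_ring word_monoid_monoid)

lemma artin_image_carrier:
  assumes "w \<in> lists (bmw_gens n)"
  shows "artin_image n m w \<in> carrier (artin_algebra n m)"
proof -
  interpret scalar_ring "artin_algebra n m" by (rule artin_algebra_scalar_ring)
  show ?thesis
    using artin_letter_gwords[OF assms]
    by (auto simp: artin_image_def artin_group_def presented_group_carrier intro!: delta_carrier)
       (use zero_closed in \<open>simp add: artin_group_def\<close>)
qed

text \<open>The words containing some \<open>E\<^sub>i\<close> form a two-sided ideal of the free monoid, and its complement is
  a submonoid on which the class of the spelled group word is multiplicative. So sending the ideal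
  to zero is consistent with multiplication.\<close>

lemma artin_image_append:
  assumes "u \<in> lists (bmw_gens n)" "v \<in> lists (bmw_gens n)"
  shows "artin_image n m (u @ v) = artin_image n m u \<otimes>\<^bsub>artin_algebra n m\<^esub> artin_image n m v"
proof -
  interpret scalar_ring "artin_algebra n m" by (rule artin_algebra_scalar_ring)
  show ?thesis
  proof (cases "\<exists>i. Letter (EL i) \<in> set (u @ v)")
    case True
    then have "artin_image n m u = \<zero>\<^bsub>artin_algebra n m\<^esub> \<or> artin_image n m v = \<zero>\<^bsub>artin_algebra n m\<^esub>"
      by (auto simp: artin_image_def)
    then show ?thesis
      using True artin_image_carrier[OF assms(1), of m] artin_image_carrier[OF assms(2), of m]
      by (auto simp: artin_image_def[of n m "u @ v"])
  next
    case False
    then show ?thesis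
      using artin_letter_gwords[OF assms(1)] artin_letter_gwords[OF assms(2)]
      by (simp add: artin_image_def delta_mult artin_group_def presented_group_mult)
  qed
qed

definition artin_hom ::
    "nat \<Rightarrow> (nat \<Rightarrow> nat \<Rightarrow> nat) \<Rightarrow> (bmw_gen list \<Rightarrow> complex) \<Rightarrow> nat gword set \<Rightarrow> complex" where
  "artin_hom n m = linear_ext (artin_image n m)"

lemma artin_hom_algebra_hom: "artin_hom n m \<in> algebra_hom (bmw_free n) (artin_algebra n m)"
  unfolding artin_hom_def bmw_free_def
proof (rule linear_ext_algebra_hom)
  show "monoid (artin_group n m)" unfolding artin_group_def by (rule presented_group_monoid)
  show "artin_image n m \<one>\<^bsub>word_monoid (bmw_gens n)\<^esub> = \<one>\<^bsub>artin_algebra n m\<^esub>"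
    by (simp add: artin_image_def monoid_algebra_one artin_group_def presented_group_one word_monoid_def)
  fix u v
  assume "u \<in> carrier (word_monoid (bmw_gens n))"
  then have u: "u \<in> lists (bmw_gens n)" by (simp add: word_monoid_def)
  then show "artin_image n m u \<in> carrier (artin_algebra n m)" by (rule artin_image_carrier)
  assume "v \<in> carrier (word_monoid (bmw_gens n))"
  then have v: "v \<in> lists (bmw_gens n)" by (simp add: word_monoid_def)
  show "artin_image n m (u \<otimes>\<^bsub>word_monoid (bmw_gens n)\<^esub> v)
      = artin_image n m u \<otimes>\<^bsub>artin_algebra n m\<^esub> artin_image n m v"
    using artin_image_append[OF u v] by (simp add: word_monoid_def)
qed (rule word_monoid_monoid)

lemma artin_hom_surj: "artin_hom n m ` carrier (bmw_free n) = carrier (artin_algebra n m)"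
  unfolding artin_hom_def bmw_free_def
proof (rule linear_ext_surj)
  fix y assume "y \<in> carrier (artin_group n m)"
  then obtain w where w: "w \<in> gwords {1..n}" "y = pres_class {1..n} (artin_rels n m) w"
    by (auto simp: artin_group_def presented_group_carrier)
  \<comment> \<open>A section of \<open>artin_letter\<close> with values in the letters that are not sent to zero.\<close>
  define g where "g = (\<lambda>(i, b). if b then Letter (XL i) else XInv i)"
  have "map artin_letter (map g w) = w" by (induction w) (auto simp: g_def)
  moreover have "Letter (EL i) \<notin> set (map g w)" for i by (auto simp: g_def split: if_splits)
  ultimately have "artin_image n m (map g w) = delta y" unfolding artin_image_def w(2) by simp
  moreover have "map g w \<in> lists (bmw_gens n)"
    using w(1) by (induction w) (auto simp: g_def bmw_gens_def)
  ultimately show "\<exists>x\<in>carrier (word_monoid (bmw_gens n)). artin_image n m x = delta y"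
    by (auto simp: word_monoid_def)
qed (auto simp: word_monoid_def artin_image_carrier)

lemma artin_hom_delta: "artin_hom n m (delta w) = artin_image n m w"
  by (simp add: artin_hom_def)

lemma map_alt: "map f (alt x y r) = alt (f x) (f y) r"
  by (induction r arbitrary: x y) auto

lemma set_alt: "set (alt x y r) \<subseteq> {x, y}"
proof (induction r arbitrary: x y)
  case (Suc r)
  then show ?case using Suc.IH[of y x] by auto
qed simp

lemma artin_image_braid:
  assumes "i \<in> {1..n}" "j \<in> {1..n}" "i \<noteq> j"
  shows "artin_image n m (alt (Letter (XL i)) (Letter (XL j)) (m i j))
       = artin_image n m (alt (Letter (XL j)) (Letter (XL i)) (m i j))"
proof -
  let ?u = "alt (i, True) (j, True) (m i j)" and ?v = "alt (j, True) (i, True) (m i j)"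
  have "?u \<in> gwords {1..n}" "?v \<in> gwords {1..n}"
    using assms set_alt[of "(i, True)" "(j, True)"] set_alt[of "(j, True)" "(i, True)"] by force+
  moreover have "(?u, ?v) \<in> artin_rels n m" using assms by (auto simp: artin_rels_def)
  ultimately have "pres_eq {1..n} (artin_rels n m) ?u ?v"
    using pres_eq.rel[of ?u ?v "artin_rels n m" "{1..n}" "[]" "[]"] by simp
  moreover have "Letter (EL l) \<notin> set (alt (Letter (XL a)) (Letter (XL b)) r)" for l a b r
    using set_alt[of "Letter (XL a)" "Letter (XL b)" r] by auto
  ultimately show ?thesis by (simp add: artin_image_def map_alt pres_class_eq)
qed

lemma artin_image_inverse:
  assumes "i \<in> {1..n}"
  shows "artin_image n m [Letter (XL i), XInv i] = \<one>\<^bsub>artin_algebra n m\<^esub>"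
    and "artin_image n m [XInv i, Letter (XL i)] = \<one>\<^bsub>artin_algebra n m\<^esub>"
proof -
  have "pres_eq {1..n} (artin_rels n m) [(i, b), (i, \<not> b)] []" for b
    using pres_eq.cancel[of i "{1..n}" "[]" "[]" "artin_rels n m" b] assms by simp
  from pres_class_eq[OF this[of True]] pres_class_eq[OF this[of False]]
  show "artin_image n m [Letter (XL i), XInv i] = \<one>\<^bsub>artin_algebra n m\<^esub>"
    and "artin_image n m [XInv i, Letter (XL i)] = \<one>\<^bsub>artin_algebra n m\<^esub>"
    by (simp_all add: artin_image_def monoid_algebra_one artin_group_def presented_group_one)
qed

lemma artin_image_EL: "Letter (EL i) \<in> set w \<Longrightarrow> artin_image n m w = \<zero>\<^bsub>artin_algebra n m\<^esub>"
  by (auto simp: artin_image_def)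

lemma artin_image_XL: "artin_image n m [Letter (XL i)] = artin_sigma n m i"
  by (simp add: artin_image_def artin_sigma_def)

lemma bmw_word_carrier: "w \<in> lists (bmw_gens n) \<Longrightarrow> delta w \<in> carrier (bmw_free n)"
  unfolding bmw_free_def by (rule delta_carrier) (simp add: word_monoid_def)

lemma hecke_ideal_ideal: "ideal (hecke_ideal n m q) (artin_algebra n m)"
  and hecke_ideal_quad: "i \<in> {1..n} \<Longrightarrow> quad (artin_algebra n m) (q i) (artin_sigma n m i) \<in> hecke_ideal n m q"
proof -
  interpret B: scalar_ring "artin_algebra n m" by (rule artin_algebra_scalar_ring)
  have sub: "{quad (artin_algebra n m) (q i) (artin_sigma n m i) | i. i \<in> {1..n}}
      \<subseteq> carrier (artin_algebra n m)"
  proof clarify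
    fix i assume "i \<in> {1..n}"
    then have "artin_sigma n m i \<in> carrier (artin_algebra n m)"
      unfolding artin_image_XL[symmetric] by (intro artin_image_carrier) (auto simp: bmw_gens_def)
    then show "quad (artin_algebra n m) (q i) (artin_sigma n m i) \<in> carrier (artin_algebra n m)"
      by (simp add: quad_def B.smult_one_closed)
  qed
  show "ideal (hecke_ideal n m q) (artin_algebra n m)"
    unfolding hecke_ideal_def by (rule B.genideal_ideal[OF sub])
  show "i \<in> {1..n} \<Longrightarrow> quad (artin_algebra n m) (q i) (artin_sigma n m i) \<in> hecke_ideal n m q"
    unfolding hecke_ideal_def using B.genideal_self[OF sub] by blast
qed

text \<open>The quadratic relation is the only one that is not already satisfied in the group algebra of
  the Artin group. There the left side goes to zero and the right side to a multiple of a generator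
  of the Hecke ideal.\<close>

lemma artin_hom_rels:
  assumes q: "\<And>i. i \<in> {1..n} \<Longrightarrow> q i = q_par \<kappa> (k i)"
    and rel: "(r, s) \<in> bmw_rels n m k \<alpha> \<kappa>"
  shows "r \<in> carrier (bmw_free n) \<and> s \<in> carrier (bmw_free n) \<and>
    artin_hom n m (r \<ominus>\<^bsub>bmw_free n\<^esub> s) \<in> hecke_ideal n m q"
proof -
  let ?F = "bmw_free n" and ?B = "artin_algebra n m" and ?h = "artin_hom n m"
  interpret F: scalar_ring ?F by (rule bmw_free_scalar_ring)
  interpret B: scalar_ring ?B by (rule artin_algebra_scalar_ring)
  interpret J: ideal "hecke_ideal n m q" ?B by (rule hecke_ideal_ideal)
  interpret hom: ring_hom_ring ?F ?B ?h
    using artin_hom_algebra_hom[of n m]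
    by (auto simp: algebra_hom_def intro!: ring_hom_ringI2 F.ring_axioms B.ring_axioms)
  have smult: "?h (c \<odot>\<^bsub>?F\<^esub> f) = c \<odot>\<^bsub>?B\<^esub> ?h f" if "f \<in> carrier ?F" for c f
    using artin_hom_algebra_hom[of n m] that by (auto simp: algebra_hom_def)
  have smult0: "c \<odot>\<^bsub>?B\<^esub> \<zero>\<^bsub>?B\<^esub> = \<zero>\<^bsub>?B\<^esub>" for c
    by (simp add: monoid_algebra_smult monoid_algebra_zero)
  have X: "Letter (XL i) \<in> bmw_gens n" and Y: "XInv i \<in> bmw_gens n" and EL: "Letter (EL i) \<in> bmw_gens n"
    if "i \<in> {1..n}" for i
    using that by (auto simp: bmw_gens_def)
  have equal: "r \<in> carrier ?F \<and> s \<in> carrier ?F \<and> ?h (r \<ominus>\<^bsub>?F\<^esub> s) \<in> hecke_ideal n m q"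
    if "r \<in> carrier ?F" "s \<in> carrier ?F" "?h r = ?h s"
    using that by (simp add: a_minus_def B.r_neg)
  have kill: "?h (delta w) = \<zero>\<^bsub>?B\<^esub>" if "Letter (EL i) \<in> set w" for w i
    using that by (simp add: artin_hom_delta artin_image_EL)
  have pair: "map Letter w \<in> lists (bmw_gens n)" if "w \<in> pair_words i j" "i \<in> {1..n}" "j \<in> {1..n}" for w i j
    using that unfolding pair_words_def bmw_gens_def by fastforce
  \<comment> \<open>The last case unites the four families of relations in which both sides are multiples of words
    containing some \<open>E\<^sub>i\<close>, or zero.\<close>
  from rel consider
      (inv1) i where "i \<in> {1..n}" "r = delta [Letter (XL i), XInv i]" "s = \<one>\<^bsub>?F\<^esub>"
    | (inv2) i where "i \<in> {1..n}" "r = delta [XInv i, Letter (XL i)]" "s = \<one>\<^bsub>?F\<^esub>"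
    | (braid) i j where "i \<in> {1..n}" "j \<in> {1..n}" "i \<noteq> j"
        "r = delta (alt (Letter (XL i)) (Letter (XL j)) (m i j))"
        "s = delta (alt (Letter (XL j)) (Letter (XL i)) (m i j))"
    | (quad) i where "i \<in> {1..n}"
        "r = (inverse (q_par \<kappa> (k i)) - q_par \<kappa> (k i)) \<odot>\<^bsub>?F\<^esub> delta [Letter (EL i)]"
        "s = l_par \<kappa> (k i) (\<alpha> i) \<odot>\<^bsub>?F\<^esub> quad ?F (q_par \<kappa> (k i)) (delta [Letter (XL i)])"
    | (E) u c v where "u \<in> lists (bmw_gens n)" "v \<in> lists (bmw_gens n)"
        "\<exists>i. Letter (EL i) \<in> set u" "\<exists>i. Letter (EL i) \<in> set v"
        "r = delta u" "s = c \<odot>\<^bsub>?F\<^esub> delta v \<or> s = \<zero>\<^bsub>?F\<^esub>"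
    unfolding bmw_rels_def Let_def
  proof (elim UnE CollectE exE conjE, goal_cases)
    case (1 i)
    then show ?thesis by (intro inv1[of i]) auto
  next
    case (2 i)
    then show ?thesis by (intro inv2[of i]) auto
  next
    case (3 i j)
    then show ?thesis by (intro braid[of i j]) auto
  next
    case (4 i)
    then show ?thesis by (intro quad[of i]) auto
  next
    case (5 i)
    then show ?thesis
      by (intro E[of "[Letter (XL i), Letter (EL i)]" "[Letter (EL i)]" "inverse (l_par \<kappa> (k i) (\<alpha> i))"])
         (auto simp: X EL)
  next
    case (6 i)
    then show ?thesis
      by (intro E[of "[Letter (EL i), Letter (XL i)]" "[Letter (EL i)]" "inverse (l_par \<kappa> (k i) (\<alpha> i))"])
         (auto simp: X EL)
  next
    case (7 i j b w)
    then show ?thesis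
      using pair[of w i j]
      by (intro E[of "map Letter ([EL b] @ w @ [EL b])" "[Letter (EL b)]" "bmw_Phi m k \<alpha> \<kappa> i j b w"])
         (auto simp: EL)
  next
    case (8 i j w)
    then show ?thesis
      using pair[of w i j]
      by (intro E[of "map Letter ([EL i] @ w @ [EL j])" "[Letter (EL i)]" 0]) (auto simp: EL)
  qed
  then show ?thesis
  proof cases
    case inv1
    then show ?thesis
      by (intro equal) (auto simp: bmw_word_carrier X Y artin_hom_delta artin_image_inverse)
  next
    case inv2
    then show ?thesis
      by (intro equal) (auto simp: bmw_word_carrier X Y artin_hom_delta artin_image_inverse)
  next
    case braid
    have "alt (Letter (XL a)) (Letter (XL b)) t \<in> lists (bmw_gens n)"
      if "a \<in> {1..n}" "b \<in> {1..n}" for a b t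
      using set_alt[of "Letter (XL a)" "Letter (XL b)" t] X that by (auto simp: in_lists_conv_set)
    with braid show ?thesis
      using artin_image_braid[of i n j m]
      by (intro equal) (auto simp: bmw_word_carrier artin_hom_delta)
  next
    case quad
    let ?x = "delta [Letter (XL i)]" and ?l = "l_par \<kappa> (k i) (\<alpha> i)"
    have x: "?x \<in> carrier ?F" and e: "delta [Letter (EL i)] \<in> carrier ?F"
      using quad by (auto simp: bmw_word_carrier X EL)
    then have quad_F: "quad ?F (q i) ?x \<in> carrier ?F"
      by (simp add: quad_def F.smult_one_closed)
    have "?h (quad ?F (q i) ?x) = quad ?B (q i) (artin_sigma n m i)"
      using F.quad_hom[OF artin_hom_algebra_hom B.ring_axioms x]
      by (simp add: artin_hom_delta artin_image_XL)
    then have "?h (quad ?F (q i) ?x) \<in> hecke_ideal n m q" using hecke_ideal_quad quad(1) by simp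
    then have "?l \<odot>\<^bsub>?B\<^esub> ?h (quad ?F (q i) ?x) \<in> hecke_ideal n m q"
      by (subst B.smult_eq) (auto intro: J.I_l_closed B.smult_one_closed J.Icarr)
    then have "?h s \<in> hecke_ideal n m q"
      using quad q quad_F by (simp add: smult)
    moreover have "?h r = \<zero>\<^bsub>?B\<^esub>"
      using quad e by (simp add: smult kill smult0)
    moreover have "r \<in> carrier ?F" "s \<in> carrier ?F"
      using quad q quad_F e by (auto simp: F.smult_closed)
    ultimately show ?thesis
      by (simp add: a_minus_def)
  next
    case E
    then have "r \<in> carrier ?F" "?h r = \<zero>\<^bsub>?B\<^esub>" "delta v \<in> carrier ?F" "?h (delta v) = \<zero>\<^bsub>?B\<^esub>"
      using kill by (auto simp: bmw_word_carrier)
    with E(6) show ?thesis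
      by (intro equal) (auto simp: smult smult0 F.smult_closed)
  qed
qed

text \<open>The preimage of the Hecke ideal is an ideal containing the generators of the BMW ideal, hence
  all of it.\<close>

lemma artin_hom_bmw_ideal:
  assumes q: "\<And>i. i \<in> {1..n} \<Longrightarrow> q i = q_par \<kappa> (k i)"
  shows "ideal (bmw_ideal n m k \<alpha> \<kappa>) (bmw_free n)"
    and "artin_hom n m ` bmw_ideal n m k \<alpha> \<kappa> \<subseteq> hecke_ideal n m q"
proof -
  let ?F = "bmw_free n" and ?B = "artin_algebra n m" and ?h = "artin_hom n m"
  let ?R = "{r \<ominus>\<^bsub>?F\<^esub> s | r s. (r, s) \<in> bmw_rels n m k \<alpha> \<kappa>}"
  interpret F: scalar_ring ?F by (rule bmw_free_scalar_ring)
  interpret B: scalar_ring ?B by (rule artin_algebra_scalar_ring)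
  interpret hom: ring_hom_ring ?F ?B ?h
    using artin_hom_algebra_hom[of n m]
    by (auto simp: algebra_hom_def intro!: ring_hom_ringI2 F.ring_axioms B.ring_axioms)
  note rels = artin_hom_rels[of n q \<kappa> k, OF q]
  have R: "?R \<subseteq> {f \<in> carrier ?F. ?h f \<in> hecke_ideal n m q}"
    using rels by (auto intro!: F.minus_closed)
  then show "ideal (bmw_ideal n m k \<alpha> \<kappa>) ?F"
    unfolding bmw_ideal_def by (intro F.genideal_ideal) auto
  have "ideal {f \<in> carrier ?F. ?h f \<in> hecke_ideal n m q} ?F"
    using hom.ideal_vimage[OF hecke_ideal_ideal] .
  from F.genideal_minimal[OF this R]
  show "?h ` bmw_ideal n m k \<alpha> \<kappa> \<subseteq> hecke_ideal n m q"
    unfolding bmw_ideal_def by auto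
qed

theorem proposition5p1:
  fixes n :: nat and m :: "nat \<Rightarrow> nat \<Rightarrow> nat"
    and k \<alpha> q :: "nat \<Rightarrow> complex" and \<kappa> :: complex
  assumes "coxeter_matrix n m"
    and "\<And>i. i \<in> {1..n} \<Longrightarrow> k i \<noteq> 0"
    and "\<And>i j. i \<in> {1..n} \<Longrightarrow> j \<in> {1..n} \<Longrightarrow> gens_conjugate n m i j
           \<Longrightarrow> k i = k j \<and> \<alpha> i = \<alpha> j"
    and "\<And>i. i \<in> {1..n} \<Longrightarrow> q i = exp (\<kappa> * \<i> * of_real pi * k i)"
    and "\<And>i. i \<in> {1..n} \<Longrightarrow> (q i)\<^sup>2 \<noteq> 1"
    and "\<And>i j a. i \<in> {1..n} \<Longrightarrow> j \<in> {1..n} \<Longrightarrow> i < j \<Longrightarrow> a \<in> {0, 1}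
           \<Longrightarrow> vec_space.rank (m i j)
                 (lk_e (m i j) (pair_param k i j) (pair_param \<alpha> i j) \<kappa> a) = 1"
  shows "\<exists>\<phi> \<in> algebra_hom (bmw_algebra n m k \<alpha> \<kappa>) (hecke_algebra n m q).
           (\<forall>i\<in>{1..n}. \<phi> (bmw_X n m k \<alpha> \<kappa> i) = hecke_sigma n m q i) \<and>
           (\<forall>i\<in>{1..n}. \<phi> (bmw_E n m k \<alpha> \<kappa> i) = \<zero>\<^bsub>hecke_algebra n m q\<^esub>) \<and>
           \<phi> ` carrier (bmw_algebra n m k \<alpha> \<kappa>) = carrier (hecke_algebra n m q)"
proof -
  let ?F = "bmw_free n" and ?B = "artin_algebra n m" and ?h = "artin_hom n m"
  let ?I = "bmw_ideal n m k \<alpha> \<kappa>" and ?J = "hecke_ideal n m q"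
  let ?\<phi> = "quot_map ?B ?J ?h"
  interpret F: scalar_ring ?F by (rule bmw_free_scalar_ring)
  interpret B: scalar_ring ?B by (rule artin_algebra_scalar_ring)
  have q: "q i = q_par \<kappa> (k i)" if "i \<in> {1..n}" for i
    using assms(4)[OF that] by (simp add: q_par_def mult_ac)
  have I: "ideal ?I ?F" by (rule artin_hom_bmw_ideal(1)[OF q])
  have IJ: "?h ` ?I \<subseteq> ?J" by (rule artin_hom_bmw_ideal(2)[OF q])
  interpret J: ideal ?J ?B by (rule hecke_ideal_ideal)
  note quot = F.scalar_ring_axioms B.scalar_ring_axioms I hecke_ideal_ideal artin_hom_algebra_hom IJ
  note coset = quot_map_coset[OF quot]
  have gen: "delta [Letter (XL i)] \<in> carrier ?F" "delta [Letter (EL i)] \<in> carrier ?F" if "i \<in> {1..n}" for i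
    using that by (auto intro!: bmw_word_carrier simp: bmw_gens_def)
  show ?thesis
  proof (intro bexI conjI ballI)
    show "?\<phi> \<in> algebra_hom (bmw_algebra n m k \<alpha> \<kappa>) (hecke_algebra n m q)"
      unfolding bmw_algebra_def hecke_algebra_def by (rule quot_map_algebra_hom[OF quot])
    fix i assume i: "i \<in> {1..n}"
    show "?\<phi> (bmw_X n m k \<alpha> \<kappa> i) = hecke_sigma n m q i"
      unfolding bmw_X_def hecke_sigma_def coset[OF gen(1)[OF i]] artin_hom_delta artin_image_XL ..
    have "?\<phi> (bmw_E n m k \<alpha> \<kappa> i) = ?J +>\<^bsub>?B\<^esub> \<zero>\<^bsub>?B\<^esub>"
      unfolding bmw_E_def coset[OF gen(2)[OF i]] by (simp add: artin_hom_delta artin_image_EL)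
    also have "\<dots> = \<zero>\<^bsub>hecke_algebra n m q\<^esub>"
      using J.a_rcos_const J.zero_closed by (simp add: hecke_algebra_def quot_algebra_def FactRing_def)
    finally show "?\<phi> (bmw_E n m k \<alpha> \<kappa> i) = \<zero>\<^bsub>hecke_algebra n m q\<^esub>" .
  next
    have "?\<phi> ` carrier (quot_algebra ?F ?I) = (\<lambda>f. ?J +>\<^bsub>?B\<^esub> ?h f) ` carrier ?F"
      unfolding F.quot_algebra_carrier[OF I] image_image by (intro image_cong HOL.refl coset)
    also have "\<dots> = (\<lambda>g. ?J +>\<^bsub>?B\<^esub> g) ` carrier ?B"
      unfolding artin_hom_surj[symmetric] image_image ..
    finally show "?\<phi> ` carrier (bmw_algebra n m k \<alpha> \<kappa>) = carrier (hecke_algebra n m q)"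
      by (simp add: bmw_algebra_def hecke_algebra_def B.quot_algebra_carrier[OF hecke_ideal_ideal])
  qed
qed

end
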